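(* Consider the split version of the Fubini–Study metric on the symmetric space $K/H=Sl(3,\mathbb{R})/Gl(2,\mathbb{R})$, given in the exponential coordinates $(x_1,x_2,x_3,x_4)$ described in the context by $$g=dx_1dx_3+dx_3dx_1+dx_2dx_4+dx_4dx_2-2(x_3dx_1+x_4dx_2)^2.$$ The following curves $\gamma=(\gamma_1,\gamma_2,\gamma_3,\gamma_4)$ are conformal circles (up to parametrization) for all $c\in\mathbb{R}$, $c>0$: $$\gamma_1=\frac{2c^2-t}{2c^3},\qquad\gamma_2=-\frac1{2c^3t},\qquad\gamma_3=\frac1t,\qquad\gamma_4=t,$$ and their $K$-orbit is of co-homogeneity one.
   Context: Exponential coordinates: $(x_1,x_2,x_3,x_4)\mapsto\left[\begin{smallmatrix} 1 & 0 & 0 \\ x_1 & 1 & 0 \\ x_2 & 0 & 1 \end{smallmatrix}\right]\left[\begin{smallmatrix} 1 & x_3 & x_4 \\ 0 & 1 & 0 \\ 0 & 0 & 1 \end{smallmatrix}\right]o$, where $o$ is the base point of $Sl(3,\mathbb{R})/Gl(2,\mathbb{R})$ and $Gl(2,\mathbb{R})$ is the block diagonal (sizes $1,2$) subgroup of $Sl(3,\mathbb{R})$; $g$ is the $Sl(3,\mathbb{R})$-invariant metric of split signature $(2,2)$ (unique up to constant multiple). The parameter $t\neq0$. The group $K=Sl(3,\mathbb{R})$ acts on $K/H$ by isometries of $g$ and hence acts on the conformal circles; "$K$-orbit" refers to this action. Conformal circles: for a metric $g$ in the conformal class with Levi-Civita connection $\nabla$ and Schouten tensor $\mathsf{P}=\frac1{m-2}\big(\mathrm{Ric}-\frac{\mathrm{Scal}}{2(m-1)}g\big)$,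 $m=\dim M$, the standard tractor bundle is $\mathbb{R}\oplus TM\oplus\mathbb{R}$ with connection $\nabla_Y(\rho,\mu,\sigma)=(Y\rho-\mathsf{P}(Y,\mu),\ \nabla_Y\mu+\rho Y+\sigma\mathsf{P}^\sharp(Y),\ Y\sigma-g(Y,\mu))$. For a nowhere null curve $\gamma$ with $u=\sqrt{g(\gamma',\gamma')}$ (real and positive for the curves above) put $X^\gamma=(1/u,0,0)$, $U^\gamma=\nabla_{\gamma'}X^\gamma$, $A^\gamma=\nabla_{\gamma'}U^\gamma$. The curve is (up to parametrization) a conformal circle iff $X^\gamma\wedge U^\gamma\wedge A^\gamma\wedge\nabla_{\gamma'}A^\gamma=0$. *)

theory Defs
  imports "HOL-Analysis.Analysis" "HOL-Algebra.Coset"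
begin

section \<open>Pseudo-Riemannian metrics in a coordinate chart\<close>

text \<open>A metric on the coordinate space \<^typ>\<open>real ^ 'n\<close> is given as a field of bilinear forms.\<close>

type_synonym 'n metric = "real ^ 'n \<Rightarrow> real ^ 'n \<Rightarrow> real ^ 'n \<Rightarrow> real"

definition partial_deriv :: "'n::finite \<Rightarrow> (real ^ 'n \<Rightarrow> real) \<Rightarrow> real ^ 'n \<Rightarrow> real" where
  "partial_deriv i f x = frechet_derivative f (at x) (axis i 1)"

definition gram :: "'n::finite metric \<Rightarrow> real ^ 'n \<Rightarrow> real ^ 'n ^ 'n" where
  "gram g x = (\<chi> i j. g x (axis i 1) (axis j 1))"

definition christoffel :: "'n::finite metric \<Rightarrow> 'n \<Rightarrow> 'n \<Rightarrow> 'n \<Rightarrow> real ^ 'n \<Rightarrow> real" where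
  "christoffel g k i j x =
     (\<Sum>l\<in>UNIV. matrix_inv (gram g x) $ k $ l *
        (partial_deriv i (\<lambda>y. gram g y $ j $ l) x
         + partial_deriv j (\<lambda>y. gram g y $ i $ l) x
         - partial_deriv l (\<lambda>y. gram g y $ i $ j) x)) / 2"

text \<open>The sign is the one for which round spheres have positive Ricci curvature.\<close>

definition ricci :: "'n::finite metric \<Rightarrow> 'n \<Rightarrow> 'n \<Rightarrow> real ^ 'n \<Rightarrow> real" where
  "ricci g i j x =
     (\<Sum>k\<in>UNIV. partial_deriv k (christoffel g k i j) x - partial_deriv j (christoffel g k i k) x)
     + (\<Sum>k\<in>UNIV. \<Sum>l\<in>UNIV. christoffel g k k l x * christoffel g l i j x
                          - christoffel g k j l x * christoffel g l i k x)"

definition scal :: "'n::finite metric \<Rightarrow> real ^ 'n \<Rightarrow> real" where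
  "scal g x = (\<Sum>i\<in>UNIV. \<Sum>j\<in>UNIV. matrix_inv (gram g x) $ i $ j * ricci g i j x)"

definition schouten :: "'n::finite metric \<Rightarrow> real ^ 'n \<Rightarrow> real ^ 'n \<Rightarrow> real ^ 'n \<Rightarrow> real" where
  "schouten g x v w =
     (let m = real CARD('n) in
       1 / (m - 2) * ((\<Sum>i\<in>UNIV. \<Sum>j\<in>UNIV. ricci g i j x * v $ i * w $ j)
                      - scal g x / (2 * (m - 1)) * g x v w))"

definition schouten_sharp :: "'n::finite metric \<Rightarrow> real ^ 'n \<Rightarrow> real ^ 'n \<Rightarrow> real ^ 'n" where
  "schouten_sharp g x v = matrix_inv (gram g x) *v (\<chi> i. schouten g x v (axis i 1))"


section \<open>Standard tractors along a curve and conformal circles\<close>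

text \<open>A triple is \<open>(\<rho>, \<mu>, \<sigma>)\<close>.  Along a curve the tractor connection is
  the pull-back connection, so the derivative applies to sections defined on the curve only.\<close>

type_synonym 'n tractor = "real \<times> (real ^ 'n) \<times> real"

definition tractor_deriv ::
    "'n::finite metric \<Rightarrow> (real \<Rightarrow> real ^ 'n) \<Rightarrow> (real \<Rightarrow> 'n tractor) \<Rightarrow> real \<Rightarrow> 'n tractor" where
  "tractor_deriv g \<gamma> s t =
     (let x = \<gamma> t;
          Y = vector_derivative \<gamma> (at t);
          (\<rho>, \<mu>, \<sigma>) = s t;
          (\<rho>', \<mu>', \<sigma>') = vector_derivative s (at t)
      in (\<rho>' - schouten g x Y \<mu>,
          (\<mu>' + (\<chi> k. \<Sum>i\<in>UNIV. \<Sum>j\<in>UNIV. christoffel g k i j x * Y $ i * \<mu> $ j))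
            + \<rho> *\<^sub>R Y + \<sigma> *\<^sub>R schouten_sharp g x Y,
          \<sigma>' - g x Y \<mu>))"

text \<open>The wedge product of four vectors as an element of the fourth exterior power, which is
  identified with the alternating 4-forms on the dual space; covectors are written as vectors by means of the
  auxiliary Euclidean inner product, so the value is the determinant of the pairings.\<close>

definition wedge4 :: "'a::euclidean_space \<Rightarrow> 'a \<Rightarrow> 'a \<Rightarrow> 'a \<Rightarrow> 'a ^ 4 \<Rightarrow> real" where
  "wedge4 v1 v2 v3 v4 = (\<lambda>w. det (\<chi> i j. (vector [v1, v2, v3, v4] :: 'a ^ 4) $ i \<bullet> w $ j))"

definition smooth_curve_on :: "real set \<Rightarrow> (real \<Rightarrow> 'a::real_normed_vector) \<Rightarrow> bool" where
  "smooth_curve_on S \<gamma> \<longleftrightarrow>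
     (\<forall>n. \<forall>t\<in>S. ((\<lambda>f t. vector_derivative f (at t)) ^^ n) \<gamma> differentiable (at t))"

text \<open>Only nowhere null curves with \<open>g(\<gamma>', \<gamma>') > 0\<close> are covered, so that \<open>u\<close> is real
  and positive.  The condition does not depend on the parametrization.\<close>

definition conformal_circle_on :: "'n::finite metric \<Rightarrow> real set \<Rightarrow> (real \<Rightarrow> real ^ 'n) \<Rightarrow> bool" where
  "conformal_circle_on g S \<gamma> \<longleftrightarrow>
     open S \<and> smooth_curve_on S \<gamma> \<and>
     (\<forall>t\<in>S. g (\<gamma> t) (vector_derivative \<gamma> (at t)) (vector_derivative \<gamma> (at t)) > 0) \<and>
     (let u = (\<lambda>t. sqrt (g (\<gamma> t) (vector_derivative \<gamma> (at t)) (vector_derivative \<gamma> (at t))));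
          X = (\<lambda>t. (1 / u t, 0, 0));
          U = tractor_deriv g \<gamma> X;
          A = tractor_deriv g \<gamma> U
      in \<forall>t\<in>S. wedge4 (X t) (U t) (A t) (tractor_deriv g \<gamma> A t) = (\<lambda>_. 0))"


section \<open>The symmetric space\<close>

definition SL3 :: "(real ^ 3 ^ 3) monoid" where
  "SL3 = \<lparr>carrier = {A. det A = 1}, mult = (**), one = mat 1\<rparr>"

definition GL2 :: "(real ^ 3 ^ 3) set" where
  "GL2 = {A \<in> carrier SL3. A $ 1 $ 2 = 0 \<and> A $ 1 $ 3 = 0 \<and> A $ 2 $ 1 = 0 \<and> A $ 3 $ 1 = 0}"

text \<open>The point of \<open>SL3/GL2\<close>, a left coset, with the given exponential coordinates.\<close>

definition exp_coords :: "real ^ 4 \<Rightarrow> (real ^ 3 ^ 3) set" where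
  "exp_coords x =
     ((vector [vector [1, 0, 0], vector [x $ 1, 1, 0], vector [x $ 2, 0, 1]] :: real ^ 3 ^ 3)
      ** (vector [vector [1, x $ 3, x $ 4], vector [0, 1, 0], vector [0, 0, 1]] :: real ^ 3 ^ 3)) <#\<^bsub>SL3\<^esub> GL2"

definition split_fubini_study :: "4 metric" where
  "split_fubini_study x v w =
     v $ 1 * w $ 3 + v $ 3 * w $ 1 + v $ 2 * w $ 4 + v $ 4 * w $ 2
     - 2 * ((x $ 3 * v $ 1 + x $ 4 * v $ 2) * (x $ 3 * w $ 1 + x $ 4 * w $ 2))"

definition circle :: "real \<Rightarrow> real \<Rightarrow> real ^ 4" where
  "circle c t = vector [(2 * c^2 - t) / (2 * c^3), - 1 / (2 * c^3 * t), 1 / t, t]"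


section \<open>Unparametrized curves and cohomogeneity one\<close>

text \<open>An unparametrized curve is the set of its points (left cosets); the group acts on
  points by left translation and hence on curves.\<close>

definition translate_curve :: "real ^ 3 ^ 3 \<Rightarrow> (real ^ 3 ^ 3) set set \<Rightarrow> (real ^ 3 ^ 3) set set" where
  "translate_curve k C = (\<lambda>p. k <#\<^bsub>SL3\<^esub> p) ` C"

definition circle_curve :: "real \<Rightarrow> (real ^ 3 ^ 3) set set" where
  "circle_curve c = {exp_coords (circle c t) | t. t \<noteq> 0}"

definition topological_manifold :: "nat \<Rightarrow> 'a topology \<Rightarrow> bool" where
  "topological_manifold n X \<longleftrightarrow>
     Hausdorff_space X \<and> second_countable X \<and>
     (\<forall>x\<in>topspace X. \<exists>U V. openin X U \<and> x \<in> U \<and> openin (Euclidean_space n) V \<and>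
        subtopology X U homeomorphic_space subtopology (Euclidean_space n) V)"

text \<open>\<open>F\<close> is a family of elements of a set on which the group acts, with parameter in \<open>I\<close>.
  The orbit of the family is the union \<open>N\<close> of the orbits of its members; its topology is the
  quotient topology (determined by \<^const>\<open>quotient_map\<close>) induced by the parametrization
  \<open>(k, c) \<mapsto> k \<cdot> F c\<close> of \<open>N\<close>.  The condition is that \<open>N\<close> is a manifold in
  which the group orbits are manifolds of codimension one.\<close>

definition orbit_of_cohomogeneity_one ::
    "('k::topological_space) monoid \<Rightarrow> ('k \<Rightarrow> 'a \<Rightarrow> 'a) \<Rightarrow> real set \<Rightarrow> (real \<Rightarrow> 'a) \<Rightarrow> bool" where
  "orbit_of_cohomogeneity_one G act I F \<longleftrightarrow>
     (\<exists>N d. quotient_map (prod_topology (top_of_set (carrier G)) (top_of_set I)) N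
               (\<lambda>(k, c). act k (F c)) \<and>
            topological_manifold (d + 1) N \<and>
            (\<forall>c\<in>I. topological_manifold d (subtopology N ((\<lambda>k. act k (F c)) ` carrier G))))"


section \<open>Basic facts\<close>

lemma vector_4 [simp]:
  "(vector [x, y, z, w] :: 'a::zero ^ 4) $ 1 = x"
  "(vector [x, y, z, w] :: 'a::zero ^ 4) $ 2 = y"
  "(vector [x, y, z, w] :: 'a::zero ^ 4) $ 3 = z"
  "(vector [x, y, z, w] :: 'a::zero ^ 4) $ 4 = w"
  unfolding vector_def by simp_all

lemma group_SL3: "group SL3"
proof (rule groupI)
  fix A assume "A \<in> carrier SL3"
  then have d: "det A = 1" by (simp add: SL3_def)
  then have "invertible A" by (simp add: invertible_det_nz)
  then obtain B where B: "A ** B = mat 1" "B ** A = mat 1"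
    by (auto simp: invertible_def)
  then have "det B = 1"
    using d det_mul[of B A] by simp
  then show "\<exists>B\<in>carrier SL3. B \<otimes>\<^bsub>SL3\<^esub> A = \<one>\<^bsub>SL3\<^esub>"
    using B by (auto simp: SL3_def)
qed (auto simp: SL3_def det_mul matrix_mul_assoc)

lemma subgroup_GL2: "subgroup GL2 SL3"
proof (rule group.subgroupI[OF group_SL3])
  fix A assume A: "A \<in> GL2"
  then have cA: "A \<in> carrier SL3" by (simp add: GL2_def)
  define B where "B = inv\<^bsub>SL3\<^esub> A"
  have cB: "B \<in> carrier SL3"
    unfolding B_def using group.inv_closed[OF group_SL3 cA] .
  have AB: "A ** B = mat 1" "B ** A = mat 1"
    using group.r_inv[OF group_SL3 cA] group.l_inv[OF group_SL3 cA]
    by (simp_all add: B_def SL3_def)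
  have z: "A $ 1 $ 2 = 0" "A $ 1 $ 3 = 0" "A $ 2 $ 1 = 0" "A $ 3 $ 1 = 0" and d: "det A = 1"
    using A by (auto simp: GL2_def SL3_def)
  have nz: "A $ 1 $ 1 \<noteq> 0" using d z by (auto simp: det_3)
  have e: "(\<Sum>k\<in>UNIV. A $ i $ k * B $ k $ j) = mat 1 $ i $ j"
          "(\<Sum>k\<in>UNIV. B $ i $ k * A $ k $ j) = (mat 1 :: real ^ 3 ^ 3) $ i $ j" for i j
    using AB by (simp_all add: vec_eq_iff matrix_matrix_mult_def)
  have "B $ 1 $ 2 = 0" "B $ 1 $ 3 = 0" "B $ 2 $ 1 = 0" "B $ 3 $ 1 = 0"
    using e(1)[of 1 2] e(1)[of 1 3] e(2)[of 2 1] e(2)[of 3 1] z nz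
    by (simp_all add: sum_3 mat_def)
  with cB show "inv\<^bsub>SL3\<^esub> A \<in> GL2" by (simp add: GL2_def B_def)
next
  have "mat 1 \<in> GL2" by (simp add: GL2_def SL3_def mat_def det_3)
  then show "GL2 \<noteq> {}" by blast
next
  fix A B assume "A \<in> GL2" "B \<in> GL2"
  moreover from this have "det (A ** B) = 1" by (simp add: det_mul GL2_def SL3_def)
  ultimately show "A \<otimes>\<^bsub>SL3\<^esub> B \<in> GL2"
    by (simp add: GL2_def SL3_def) (simp add: matrix_matrix_mult_def sum_3)
qed (auto simp: GL2_def)

lemma exp_coords_representative:
  "(vector [vector [1, 0, 0], vector [x $ 1, 1, 0], vector [x $ 2, 0, 1]] :: real ^ 3 ^ 3)
      ** (vector [vector [1, x $ 3, x $ 4], vector [0, 1, 0], vector [0, 0, 1]] :: real ^ 3 ^ 3)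
   \<in> carrier SL3" for x :: "real ^ 4"
  by (simp add: SL3_def det_mul) (simp add: det_3)

end

theory Submission
  imports Defs
begin

text \<open>The metric is Einstein with \<open>Ric = - 3 g\<close>, so that \<open>P = - g / 2\<close>, and
  along \<open>\<gamma>\<close> one finds that \<open>\<nabla>A\<close> is a combination of \<open>U\<close> and \<open>X\<close>.

  For the orbit, a point of the symmetric space is a projection onto a line of \<open>\<real>\<^sup>3\<close>.
  After a unipotent change of frame, the lines along the circle with parameter \<open>c\<close> form a
  conic without two points, and the curve is an orbit of the group of the matrices
  \<open>diag(1, s, 1 / s)\<close>.  An element of the group that maps one of these
  curves to another maps conic to conic and preserves the pair of missing points, so it lies in the
  normalizer of this one-dimensional torus; a diagonal entry of the
  projections shows that then \<open>c\<close> is the same.  So the curves are parametrized by the product of the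
  7-dimensional quotient of the group by the normalizer and the half line of the parameters.\<close>

section \<open>Curvature of the split Fubini-Study metric\<close>

text \<open>A set of unparametrized curves has no topology of its own; it receives the quotient
  topology from the pairs \<open>(k, c)\<close>, so everything about it has to be derived from
  knowing when two pairs give the same curve. The stabilizers of different circles are different
  subgroups, conjugate to each other by \<open>frame c\<close>. Replacing \<open>k\<close> by
  \<open>k ** frame c\<close> makes them one subgroup acting from the right, independent of
  \<open>c\<close>; this is where the product structure comes from.

  The conic alone does not determine \<open>c\<close>: all conics l^2 v_1^2 = v_2 v_3 are equivalent
  under diagonal matrices of determinant 1. The complementary planes are needed as well, and they
  enter through the projections.

  On the metric side, 1/u is linear in \<open>t\<close> on each half line, so after fixing the sign
  of \<open>t\<close> all tractors are rational in \<open>t\<close>.\<close>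

lemma partial_deriv_eq:
  "(f has_derivative f') (at x) \<Longrightarrow> partial_deriv i f x = f' (axis i 1)"
  by (simp add: partial_deriv_def flip: frechet_derivative_at)

lemma matrix_inv_eqI:
  fixes A B :: "real ^ 'n ^ 'n"
  assumes "A ** B = mat 1"
  shows "matrix_inv A = B"
proof -
  have "invertible A"
    using assms by (metis invertible_def matrix_left_right_inverse)
  then have "matrix_inv A ** A = mat 1"
    unfolding invertible_def matrix_inv_def by (metis (mono_tags, lifting) someI_ex)
  then show ?thesis
    using assms by (metis matrix_mul_assoc matrix_mul_lid matrix_mul_rid)
qed

text \<open>The Gram matrix is \<open>J - 2 a a\<^sup>T\<close>, where \<open>a\<close> is the covector
  \<open>x\<^sub>3 dx\<^sub>1 + x\<^sub>4 dx\<^sub>2\<close> and \<open>J\<close> swaps the indices 1, 3 and the indices 2, 4.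
  With \<open>b = J a\<close> the inverse is \<open>J + 2 b b\<^sup>T\<close>.\<close>

definition fs_a :: "4 \<Rightarrow> real ^ 4 \<Rightarrow> real" where
  "fs_a i x = (if i = 1 then x $ 3 else if i = 2 then x $ 4 else 0)"

definition fs_b :: "4 \<Rightarrow> real ^ 4 \<Rightarrow> real" where
  "fs_b i x = (if i = 3 then x $ 3 else if i = 4 then x $ 4 else 0)"

definition fs_J :: "4 \<Rightarrow> 4 \<Rightarrow> real" where
  "fs_J i j = (if (i, j) \<in> {(1, 3), (3, 1), (2, 4), (4, 2)} then 1 else 0)"

definition fs_e :: "4 \<Rightarrow> real" where
  "fs_e i = (if i = 1 \<or> i = 2 then - 1 else 1)"

definition fs_d :: "4 \<Rightarrow> 4 \<Rightarrow> real" where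
  "fs_d i j = (if i = j then 1 else 0)"

text \<open>Differentiation is carried out with symbolic indices; only the finite sums are expanded,
  and this table turns each summand into a polynomial in the coordinates.\<close>

lemma fs_table:
  "fs_J 1 1 = 0" "fs_d 1 1 = 1" "(axis 1 1 :: real ^ 4) $ 1 = 1"
  "fs_J 1 2 = 0" "fs_d 1 2 = 0" "(axis 2 1 :: real ^ 4) $ 1 = 0"
  "fs_J 1 3 = 1" "fs_d 1 3 = 0" "(axis 3 1 :: real ^ 4) $ 1 = 0"
  "fs_J 1 4 = 0" "fs_d 1 4 = 0" "(axis 4 1 :: real ^ 4) $ 1 = 0"
  "fs_J 2 1 = 0" "fs_d 2 1 = 0" "(axis 1 1 :: real ^ 4) $ 2 = 0"
  "fs_J 2 2 = 0" "fs_d 2 2 = 1" "(axis 2 1 :: real ^ 4) $ 2 = 1"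
  "fs_J 2 3 = 0" "fs_d 2 3 = 0" "(axis 3 1 :: real ^ 4) $ 2 = 0"
  "fs_J 2 4 = 1" "fs_d 2 4 = 0" "(axis 4 1 :: real ^ 4) $ 2 = 0"
  "fs_J 3 1 = 1" "fs_d 3 1 = 0" "(axis 1 1 :: real ^ 4) $ 3 = 0"
  "fs_J 3 2 = 0" "fs_d 3 2 = 0" "(axis 2 1 :: real ^ 4) $ 3 = 0"
  "fs_J 3 3 = 0" "fs_d 3 3 = 1" "(axis 3 1 :: real ^ 4) $ 3 = 1"
  "fs_J 3 4 = 0" "fs_d 3 4 = 0" "(axis 4 1 :: real ^ 4) $ 3 = 0"
  "fs_J 4 1 = 0" "fs_d 4 1 = 0" "(axis 1 1 :: real ^ 4) $ 4 = 0"
  "fs_J 4 2 = 1" "fs_d 4 2 = 0" "(axis 2 1 :: real ^ 4) $ 4 = 0"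
  "fs_J 4 3 = 0" "fs_d 4 3 = 0" "(axis 3 1 :: real ^ 4) $ 4 = 0"
  "fs_J 4 4 = 0" "fs_d 4 4 = 1" "(axis 4 1 :: real ^ 4) $ 4 = 1"
  "fs_a 1 x = x $ 3" "fs_a 2 x = x $ 4" "fs_a 3 x = 0" "fs_a 4 x = 0"
  "fs_b 1 x = 0" "fs_b 2 x = 0" "fs_b 3 x = x $ 3" "fs_b 4 x = x $ 4"
  "fs_e 1 = - 1" "fs_e 2 = - 1" "fs_e 3 = 1" "fs_e 4 = 1"
  by (simp_all add: fs_J_def fs_d_def fs_a_def fs_b_def fs_e_def axis_def)

lemma fs_a_has_derivative [derivative_intros]:
  "(fs_a i has_derivative fs_a i) (at x)"
proof -
  have "bounded_linear (fs_a i)"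
    unfolding fs_a_def[abs_def] by (cases "i = 1"; cases "i = 2"; cases "i = 3"; cases "i = 4") (simp_all add: bounded_linear_vec_nth)
  then show ?thesis by (rule bounded_linear_imp_has_derivative)
qed

lemma fs_b_has_derivative [derivative_intros]:
  "(fs_b i has_derivative fs_b i) (at x)"
proof -
  have "bounded_linear (fs_b i)"
    unfolding fs_b_def[abs_def] by (cases "i = 1"; cases "i = 2"; cases "i = 3"; cases "i = 4") (simp_all add: bounded_linear_vec_nth)
  then show ?thesis by (rule bounded_linear_imp_has_derivative)
qed

lemma gram_split_fubini_study:
  "gram split_fubini_study x $ i $ j = fs_J i j - 2 * fs_a i x * fs_a j x"
  using exhaust_4[of i] exhaust_4[of j]
  by (auto simp: gram_def split_fubini_study_def fs_J_def fs_a_def axis_def)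

text \<open>Since J b = a, J a = b and the supports of a and b are disjoint, (J - 2 a a^T) (J + 2 b
  b^T) = 1 + 2 a b^T - 2 a b^T = 1.\<close>

lemma matrix_inv_gram:
  "matrix_inv (gram split_fubini_study x) $ i $ j = fs_J i j + 2 * fs_b i x * fs_b j x"
proof -
  define B :: "real ^ 4 ^ 4" where "B = (\<chi> i j. fs_J i j + 2 * fs_b i x * fs_b j x)"
  have "gram split_fubini_study x ** B = mat 1"
    by (simp add: vec_eq_iff forall_4 matrix_matrix_mult_def sum_4 gram_split_fubini_study B_def
        mat_def fs_table)
  then have "matrix_inv (gram split_fubini_study x) = B"
    by (rule matrix_inv_eqI)
  then show ?thesis by (simp add: B_def)
qed

lemma christoffel_split_fubini_study:
  "christoffel split_fubini_study k i j x =
     4 * fs_b k x * fs_a i x * fs_a j x - fs_J i j * fs_b k x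
     - fs_d i k * fs_e i * fs_a j x - fs_d j k * fs_e j * fs_a i x"
proof -
  have d: "partial_deriv l (\<lambda>y. gram split_fubini_study y $ i $ j) x =
      - 2 * (fs_a i (axis l 1) * fs_a j x + fs_a i x * fs_a j (axis l 1))" for l i j
    unfolding gram_split_fubini_study
    by (subst partial_deriv_eq, (rule derivative_eq_intros refl)+) (simp add: algebra_simps)
  show ?thesis
    unfolding christoffel_def d matrix_inv_gram sum_4
    using exhaust_4[of i] exhaust_4[of j] exhaust_4[of k]
    by (elim disjE; simp add: fs_table algebra_simps)
qed

lemma partial_deriv_christoffel:
  "partial_deriv l (christoffel split_fubini_study k i j) x =
     4 * (fs_b k (axis l 1) * fs_a i x * fs_a j x + fs_b k x * fs_a i (axis l 1) * fs_a j x
        + fs_b k x * fs_a i x * fs_a j (axis l 1)) - fs_J i j * fs_b k (axis l 1)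
     - fs_d i k * fs_e i * fs_a j (axis l 1)
     - fs_d j k * fs_e j * fs_a i (axis l 1)"
proof -
  have *: "christoffel split_fubini_study k i j =
    (\<lambda>x. 4 * fs_b k x * fs_a i x * fs_a j x - fs_J i j * fs_b k x
     - fs_d i k * fs_e i * fs_a j x - fs_d j k * fs_e j * fs_a i x)"
    by (rule ext) (simp add: christoffel_split_fubini_study)
  show ?thesis
    unfolding * by (subst partial_deriv_eq, (rule derivative_eq_intros refl)+) (simp add: algebra_simps)
qed

lemma ricci_split_fubini_study:
  "ricci split_fubini_study i j x = - 3 * gram split_fubini_study x $ i $ j"
proof -
  have 1: "(\<Sum>k\<in>UNIV. partial_deriv j (christoffel split_fubini_study k i k) x) = 0"
    unfolding partial_deriv_christoffel sum_4
    using exhaust_4[of i] exhaust_4[of j]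
    by (elim disjE; simp add: fs_table)
  \<comment> \<open>This trace is the logarithmic derivative of the volume density, which is
    constant: J - 2 a a^T has determinant 1 because a and b have disjoint supports. The sum in
    \<open>1\<close> vanishes for the same reason.\<close>
  have 2: "(\<Sum>k\<in>UNIV. christoffel split_fubini_study k k l x) = 0" for l
    unfolding christoffel_split_fubini_study sum_4
    using exhaust_4[of l]
    by (elim disjE; simp add: fs_table)
  have 3: "(\<Sum>k\<in>UNIV. partial_deriv k (christoffel split_fubini_study k i j) x)
      = 16 * fs_a i x * fs_a j x - 3 * fs_J i j"
    unfolding partial_deriv_christoffel sum_4
    using exhaust_4[of i] exhaust_4[of j]
    by (elim disjE; simp add: fs_table)
  have 4: "(\<Sum>k\<in>UNIV. \<Sum>l\<in>UNIV. christoffel split_fubini_study k j l x * christoffel split_fubini_study l i k x)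
      = 10 * fs_a i x * fs_a j x"
    unfolding christoffel_split_fubini_study sum_4
    using exhaust_4[of i] exhaust_4[of j]
    by (elim disjE; simp add: fs_table)
  have 5: "(\<Sum>k\<in>UNIV. \<Sum>l\<in>UNIV. christoffel split_fubini_study k k l x * christoffel split_fubini_study l i j x) = 0"
    by (subst sum.swap) (simp add: 2 flip: sum_distrib_right)
  show ?thesis
    by (simp add: ricci_def sum_subtractf 1 3 4 5 gram_split_fubini_study)
qed

lemma scal_split_fubini_study: "scal split_fubini_study x = - 12"
  unfolding scal_def ricci_split_fubini_study gram_split_fubini_study matrix_inv_gram sum_4
  by (simp add: fs_table)

lemma split_fubini_study_gram:
  "(\<Sum>i\<in>UNIV. \<Sum>j\<in>UNIV. gram split_fubini_study x $ i $ j * v $ i * w $ j) = split_fubini_study x v w"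
  unfolding gram_split_fubini_study sum_4
  by (simp add: fs_table split_fubini_study_def algebra_simps)

text \<open>In dimension 4 the factor is (- 3 - (- 12) / 6) / 2 = - 1 / 2.\<close>

lemma schouten_split_fubini_study:
  "schouten split_fubini_study x v w = - split_fubini_study x v w / 2"
proof -
  have "(\<Sum>i\<in>UNIV. \<Sum>j\<in>UNIV. ricci split_fubini_study i j x * v $ i * w $ j)
      = - 3 * split_fubini_study x v w"
    using split_fubini_study_gram[of x v w]
    by (simp add: ricci_split_fubini_study mult.assoc sum_negf flip: sum_distrib_left)
  then show ?thesis
    by (simp add: schouten_def scal_split_fubini_study field_simps)
qed

lemma schouten_sharp_split_fubini_study:
  "schouten_sharp split_fubini_study x v = - (1 / 2) *\<^sub>R v"
  unfolding schouten_sharp_def schouten_split_fubini_study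
  by (simp add: vec_eq_iff forall_4 matrix_vector_mult_def sum_4 matrix_inv_gram
      split_fubini_study_def axis_def fs_table field_simps)

text \<open>The explicit vector is the Christoffel term contracted with \<open>Y\<close> and
  \<open>m\<close>, and \<open>h\<close> collects the multiples of b. The summands with the factor
  1/2 come from P = - g / 2.\<close>

lemma tractor_deriv_split_fubini_study:
  assumes "(\<gamma> has_vector_derivative Y) (at t)"
    and "(s has_vector_derivative (r', m', q')) (at t)" and "s t = (r, m, q)"
  shows "tractor_deriv split_fubini_study \<gamma> s t =
    (let a = \<lambda>v. \<gamma> t $ 3 * v $ 1 + \<gamma> t $ 4 * v $ 2;
         h = 4 * a Y * a m - (Y $ 1 * m $ 3 + Y $ 3 * m $ 1 + Y $ 2 * m $ 4 + Y $ 4 * m $ 2)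
     in (r' + split_fubini_study (\<gamma> t) Y m / 2,
         m' + vector [a Y * m $ 1 + a m * Y $ 1, a Y * m $ 2 + a m * Y $ 2,
              h * \<gamma> t $ 3 - a Y * m $ 3 - a m * Y $ 3, h * \<gamma> t $ 4 - a Y * m $ 4 - a m * Y $ 4]
            + (r - q / 2) *\<^sub>R Y,
         q' - split_fubini_study (\<gamma> t) Y m))"
proof -
  have "(\<chi> k. \<Sum>i\<in>UNIV. \<Sum>j\<in>UNIV. christoffel split_fubini_study k i j (\<gamma> t) * Y $ i * m $ j) =
    (let a = \<lambda>v. \<gamma> t $ 3 * v $ 1 + \<gamma> t $ 4 * v $ 2;
         h = 4 * a Y * a m - (Y $ 1 * m $ 3 + Y $ 3 * m $ 1 + Y $ 2 * m $ 4 + Y $ 4 * m $ 2)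
     in vector [a Y * m $ 1 + a m * Y $ 1, a Y * m $ 2 + a m * Y $ 2,
              h * \<gamma> t $ 3 - a Y * m $ 3 - a m * Y $ 3, h * \<gamma> t $ 4 - a Y * m $ 4 - a m * Y $ 4])"
    unfolding christoffel_split_fubini_study sum_4
    by (simp add: vec_eq_iff forall_4 fs_table algebra_simps)
  then show ?thesis
    using assms by (simp add: tractor_deriv_def vector_derivative_at schouten_split_fubini_study
        schouten_sharp_split_fubini_study Let_def scaleR_diff_left)
qed

section \<open>Tractors along the circles\<close>

lemma wedge4_span_eq_0:
  "wedge4 x y z (a *\<^sub>R x + b *\<^sub>R y) = (\<lambda>_. 0)"
proof
  fix w
  let ?r = "vector [x, y, z, a *\<^sub>R x + b *\<^sub>R y] :: 'a ^ 4"
  define M :: "real ^ 4 ^ 4" where "M = (\<chi> i j. ?r $ i \<bullet> w $ j)"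
  \<comment> \<open>The coefficients of the linear relation between the rows of \<open>M\<close>;
    the last one is nonzero.\<close>
  define v :: "real ^ 4" where "v = vector [a, b, 0, - 1]"
  have "v v* M = 0"
    by (simp add: vec_eq_iff vector_matrix_mult_def sum_4 M_def v_def inner_add_left)
  have "det M = 0"
  proof (rule ccontr)
    assume "det M \<noteq> 0"
    then obtain B where "M ** B = mat 1"
      by (auto simp: invertible_det_nz[symmetric] invertible_def)
    then have "v = (v v* M) v* B"
      by (simp add: vector_matrix_mul_assoc)
    then have "v $ 4 = 0"
      unfolding \<open>v v* M = 0\<close> by simp
    then show False by (simp add: v_def)
  qed
  then show "wedge4 x y z (a *\<^sub>R x + b *\<^sub>R y) w = 0"
    by (simp add: wedge4_def M_def)
qed

lemma has_vector_derivative_vector_4: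
  fixes f g h k :: "real \<Rightarrow> real"
  assumes "(f has_real_derivative f') (at t)" "(g has_real_derivative g') (at t)"
    "(h has_real_derivative h') (at t)" "(k has_real_derivative k') (at t)"
  shows "((\<lambda>t. vector [f t, g t, h t, k t] :: real ^ 4) has_vector_derivative
    vector [f', g', h', k']) (at t)"
proof -
  have *: "(vector [a, b, c, d] :: real ^ 4) =
      a *\<^sub>R axis 1 1 + b *\<^sub>R axis 2 1 + c *\<^sub>R axis 3 1 + d *\<^sub>R axis 4 1" for a b c d
    by (simp add: vec_eq_iff forall_4 axis_def)
  show ?thesis
    unfolding * by (rule derivative_eq_intros assms refl)+ simp
qed

text \<open>A class that contains the circles and is closed under differentiation, as smoothness is
  stated by iterating \<open>vector_derivative\<close>. Nothing is demanded at 0, where these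
  derivatives have no meaning. One inverse power is enough, since differentiation only raises its
  exponent.\<close>

definition affine_plus_inverse_power :: "(real \<Rightarrow> 'a::real_normed_vector) \<Rightarrow> bool" where
  "affine_plus_inverse_power f \<longleftrightarrow>
     (\<exists>a b d n. \<forall>t. t \<noteq> 0 \<longrightarrow> f t = a + t *\<^sub>R b + inverse (t ^ n) *\<^sub>R d)"

lemma affine_plus_inverse_power_derivative:
  assumes "affine_plus_inverse_power f"
  shows "affine_plus_inverse_power (\<lambda>t. vector_derivative f (at t))"
    and "t \<noteq> 0 \<Longrightarrow> f differentiable (at t)"
proof -
  obtain a b d n where f: "\<And>t. t \<noteq> 0 \<Longrightarrow> f t = a + t *\<^sub>R b + inverse (t ^ n) *\<^sub>R d"
    using assms unfolding affine_plus_inverse_power_def by blast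
  have D: "(f has_vector_derivative b + inverse (t ^ Suc n) *\<^sub>R (- real n *\<^sub>R d)) (at t)"
    if "t \<noteq> 0" for t
  proof (rule has_vector_derivative_transform_within_open[where S = "- {0}"])
    have "((\<lambda>t. inverse (t ^ n)) has_real_derivative - real n * inverse (t ^ Suc n)) (at t)"
    proof (cases n)
      case (Suc m)
      show ?thesis
        by (rule DERIV_cong[OF DERIV_inverse_fun[OF DERIV_pow]]) (use that in \<open>simp_all add: Suc field_simps\<close>)
    qed simp
    from has_vector_derivative_scaleR[OF this has_vector_derivative_const[of d]]
    have "((\<lambda>t. inverse (t ^ n) *\<^sub>R d) has_vector_derivative
        inverse (t ^ Suc n) *\<^sub>R (- real n *\<^sub>R d)) (at t)"
      by (simp add: mult.commute)
    moreover have "((\<lambda>t. a + t *\<^sub>R b) has_vector_derivative b) (at t)"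
      by (auto intro!: derivative_eq_intros)
    ultimately show "((\<lambda>t. a + t *\<^sub>R b + inverse (t ^ n) *\<^sub>R d)
        has_vector_derivative b + inverse (t ^ Suc n) *\<^sub>R (- real n *\<^sub>R d)) (at t)"
      by (rule has_vector_derivative_add[rotated])
  qed (use that f in auto)
  show "affine_plus_inverse_power (\<lambda>t. vector_derivative f (at t))"
    unfolding affine_plus_inverse_power_def
    by (intro exI[of _ b] exI[of _ 0] exI[of _ "- real n *\<^sub>R d"] exI[of _ "Suc n"])
      (simp add: vector_derivative_at[OF D])
  show "f differentiable (at t)" if "t \<noteq> 0"
    using D[OF that] by (auto simp: has_vector_derivative_def differentiable_def)
qed

lemma smooth_curve_circle: "smooth_curve_on {t. t \<noteq> 0} (circle c)"
proof -
  have *: "circle c t = vector [1 / c, 0, 0, 0] + t *\<^sub>R vector [- 1 / (2 * c ^ 3), 0, 0, 1]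
      + inverse (t ^ 1) *\<^sub>R vector [0, - 1 / (2 * c ^ 3), 1, 0]" for t
    by (cases "c = 0") (simp_all add: circle_def vec_eq_iff forall_4 field_simps power2_eq_square power3_eq_cube)
  have "affine_plus_inverse_power (circle c)"
    unfolding affine_plus_inverse_power_def using * by blast
  then have "affine_plus_inverse_power (((\<lambda>f t. vector_derivative f (at t)) ^^ n) (circle c))" for n
    by (induction n) (simp_all add: affine_plus_inverse_power_derivative(1))
  then show ?thesis
    by (simp add: smooth_curve_on_def affine_plus_inverse_power_derivative(2))
qed

definition circle_velocity :: "real \<Rightarrow> real \<Rightarrow> real ^ 4" where
  "circle_velocity c t = vector [- 1 / (2 * c ^ 3), 1 / (2 * c ^ 3 * t ^ 2), - 1 / t ^ 2, 1]"

lemma circle_has_vector_derivative: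
  assumes "c \<noteq> 0" "t \<noteq> 0"
  shows "(circle c has_vector_derivative circle_velocity c t) (at t)"
  unfolding circle_def circle_velocity_def
  by (rule has_vector_derivative_vector_4)
    (use assms in \<open>auto intro!: derivative_eq_intros simp: field_simps power2_eq_square\<close>)

lemma circle_velocity_norm:
  assumes "c \<noteq> 0" "t \<noteq> 0"
  shows "split_fubini_study (circle c t) (circle_velocity c t) (circle_velocity c t) = 2 / (c ^ 3 * t ^ 2)"
  using assms by (simp add: split_fubini_study_def circle_def circle_velocity_def field_simps power2_eq_square)

lemma circle_velocity_has_vector_derivative:
  assumes "c \<noteq> 0" "t \<noteq> 0"
  shows "(circle_velocity c has_vector_derivative vector [0, - 1 / (c ^ 3 * t ^ 3), 2 / t ^ 3, 0]) (at t)"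
  unfolding circle_velocity_def
  by (rule has_vector_derivative_vector_4)
    (use assms in \<open>auto intro!: derivative_eq_intros simp: field_simps power2_eq_square power3_eq_cube\<close>)

lemma tractor_frame_circle:
  fixes k :: real
  assumes S: "open S" "0 \<notin> S" and c: "c \<noteq> 0" and k: "k \<noteq> 0"
    and X: "\<And>t. t \<in> S \<Longrightarrow> X t = (k * t, 0, 0)"
  defines "U \<equiv> tractor_deriv split_fubini_study (circle c) X"
  defines "A \<equiv> tractor_deriv split_fubini_study (circle c) U"
  assumes t: "t \<in> S"
  shows "wedge4 (X t) (U t) (A t) (tractor_deriv split_fubini_study (circle c) A t) = (\<lambda>_. 0)"
proof -
  have nz: "t \<noteq> 0" if "t \<in> S" for t using that S by auto
  note Y = circle_has_vector_derivative[OF c nz]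
  have U: "U t = (k, (k * t) *\<^sub>R circle_velocity c t, 0)" if t: "t \<in> S" for t
  proof -
    have "((\<lambda>t. (k * t, 0, 0)) has_vector_derivative (k, 0, 0)) (at t)"
      by (auto intro!: derivative_eq_intros simp: has_real_derivative_iff_has_vector_derivative[symmetric] zero_prod_def)
    then have "(X has_vector_derivative (k, 0, 0)) (at t)"
      by (rule has_vector_derivative_transform_within_open[OF _ S(1) t]) (simp add: X)
    from tractor_deriv_split_fubini_study[OF Y[OF t] this X[OF t]] show ?thesis
      unfolding U_def by (simp add: split_fubini_study_def Let_def vec_eq_iff forall_4)
  qed
  have A: "A t = (k / (c ^ 3 * t),
      k *\<^sub>R vector [- 1 / c ^ 3, 0, - 2 / (c ^ 3 * t ^ 2), 2 - 2 / c ^ 3], - 2 * k / (c ^ 3 * t))"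
    if t: "t \<in> S" for t
  proof -
    have "((\<lambda>t. (k, (k * t) *\<^sub>R circle_velocity c t, 0 :: real)) has_vector_derivative
       (0, (k * t) *\<^sub>R vector [0, - 1 / (c ^ 3 * t ^ 3), 2 / t ^ 3, 0] + k *\<^sub>R circle_velocity c t, 0)) (at t)"
      using nz[OF t] c
      by (auto intro!: derivative_eq_intros circle_velocity_has_vector_derivative)
    then have "(U has_vector_derivative
       (0, (k * t) *\<^sub>R vector [0, - 1 / (c ^ 3 * t ^ 3), 2 / t ^ 3, 0] + k *\<^sub>R circle_velocity c t, 0)) (at t)"
      by (rule has_vector_derivative_transform_within_open[OF _ S(1) t]) (simp add: U)
    from tractor_deriv_split_fubini_study[OF Y[OF t] this U[OF t]] show ?thesis
      unfolding A_def using nz[OF t] c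
      by (simp add: split_fubini_study_def Let_def vec_eq_iff forall_4 circle_def circle_velocity_def
          field_simps power2_eq_square power3_eq_cube)
  qed
  define A' where "A' = (- k / (c ^ 3 * t ^ 2), k *\<^sub>R vector [0, 0, 4 / (c ^ 3 * t ^ 3), 0] :: real ^ 4,
    2 * k / (c ^ 3 * t ^ 2))"
  have "((\<lambda>t. (k / (c ^ 3 * t),
      k *\<^sub>R vector [- 1 / c ^ 3, 0, - 2 / (c ^ 3 * t ^ 2), 2 - 2 / c ^ 3] :: real ^ 4, - 2 * k / (c ^ 3 * t)))
      has_vector_derivative A') (at t)"
    unfolding A'_def
  proof (intro has_vector_derivative_Pair bounded_linear.has_vector_derivative[OF bounded_linear_scaleR_right]
      has_vector_derivative_vector_4)
    show "((\<lambda>t. k / (c ^ 3 * t)) has_vector_derivative - k / (c ^ 3 * t ^ 2)) (at t)"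
      "((\<lambda>t. - 2 * k / (c ^ 3 * t)) has_vector_derivative 2 * k / (c ^ 3 * t ^ 2)) (at t)"
      using nz[OF t] c unfolding has_real_derivative_iff_has_vector_derivative[symmetric]
      by (auto intro!: derivative_eq_intros simp: field_simps power2_eq_square)
    show "((\<lambda>t. - 2 / (c ^ 3 * t ^ 2)) has_real_derivative 4 / (c ^ 3 * t ^ 3)) (at t)"
      using nz[OF t] c
      by (auto intro!: derivative_eq_intros simp: field_simps power2_eq_square power3_eq_cube)
  qed auto
  then have "(A has_vector_derivative A') (at t)"
    by (rule has_vector_derivative_transform_within_open[OF _ S(1) t]) (simp add: A)
  note * = tractor_deriv_split_fubini_study[OF Y[OF t] this[unfolded A'_def] A[OF t]]
  \<comment> \<open>The first slot can be left as an unspecified \<open>r\<close>, because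
    \<open>X t\<close> spans that slot and absorbs it. The middle slot is a multiple of the
    velocity, and that multiple fixes the coefficient of \<open>U t\<close>.\<close>
  obtain r where "tractor_deriv split_fubini_study (circle c) A t
      = (r, (k / (c ^ 3 * t)) *\<^sub>R circle_velocity c t, 0)"
    unfolding * using nz[OF t] c
    by (simp add: split_fubini_study_def Let_def vec_eq_iff forall_4 circle_def circle_velocity_def
          field_simps power2_eq_square power3_eq_cube)
  also have "\<dots> = ((r - k / (c ^ 3 * t ^ 2)) / (k * t)) *\<^sub>R X t + (1 / (c ^ 3 * t ^ 2)) *\<^sub>R U t"
    using nz[OF t] c k by (simp add: X[OF t] U[OF t] field_simps power2_eq_square)
  finally show ?thesis
    by (simp only: wedge4_span_eq_0)
qed

lemma conformal_circle_circle:
  assumes c: "c > 0"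
  shows "conformal_circle_on split_fubini_study {t. t \<noteq> 0} (circle c)"
proof -
  let ?S = "{t::real. t \<noteq> 0}"
  have norm: "split_fubini_study (circle c t) (vector_derivative (circle c) (at t))
      (vector_derivative (circle c) (at t)) = 2 / (c ^ 3 * t ^ 2)" if "t \<noteq> 0" for t
    using that c by (simp add: vector_derivative_at[OF circle_has_vector_derivative] circle_velocity_norm)
  define X where "X = (\<lambda>t. (1 / sqrt (split_fubini_study (circle c t) (vector_derivative (circle c) (at t))
      (vector_derivative (circle c) (at t))), 0 :: real ^ 4, 0 :: real))"
  have X: "X t = (sqrt (c ^ 3 / 2) * \<bar>t\<bar>, 0, 0)" if "t \<noteq> 0" for t
    unfolding X_def norm[OF that] using c
    by (simp add: real_sqrt_divide real_sqrt_mult)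
  define U where "U = tractor_deriv split_fubini_study (circle c) X"
  define A where "A = tractor_deriv split_fubini_study (circle c) U"
  have "wedge4 (X t) (U t) (A t) (tractor_deriv split_fubini_study (circle c) A t) = (\<lambda>_. 0)"
    if "t \<noteq> 0" for t
  proof -
    \<comment> \<open>The half line containing \<open>t\<close>. On it the factor \<bar>s\<bar> of
      1/u is the linear function \<open>sgn t * s\<close>, so the sign goes into the constant
      \<open>k\<close> of \<open>tractor_frame_circle\<close>.\<close>
    have op: "open {s. 0 < sgn t * s}" by (intro open_Collect_less continuous_intros)
    have Xs: "X s = (sqrt (c ^ 3 / 2) * sgn t * s, 0, 0)" if "s \<in> {s. 0 < sgn t * s}" for s
    proof -
      have "s \<noteq> 0" and "\<bar>s\<bar> = sgn t * s" using that \<open>t \<noteq> 0\<close> by (auto simp: sgn_if split: if_splits)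
      then show ?thesis by (simp add: X)
    qed
    show ?thesis
      unfolding A_def U_def
      by (rule tractor_frame_circle[OF op _ _ _ Xs]) (use c that in \<open>auto simp: sgn_if\<close>)
  qed
  moreover have "open ?S" by (simp add: open_Collect_neq)
  moreover have "2 / (c ^ 3 * t ^ 2) > 0" if "t \<noteq> 0" for t using c that by simp
  ultimately show ?thesis
    unfolding conformal_circle_on_def Let_def X_def[symmetric] U_def[symmetric] A_def[symmetric]
    using norm smooth_curve_circle by (simp add: X_def)
qed

section \<open>The circles as curves of projections\<close>

lemma SL3_simps:
  "A \<in> carrier SL3 \<longleftrightarrow> det A = 1" "A \<otimes>\<^bsub>SL3\<^esub> B = A ** B"
  by (simp_all add: SL3_def)

lemma matrix_inv_det_1:
  fixes A :: "real ^ 'n ^ 'n"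
  assumes "det A = 1"
  shows "matrix_inv A ** A = mat 1" "A ** matrix_inv A = mat 1" "det (matrix_inv A) = 1"
    "B ** A ** matrix_inv A = B" "B ** matrix_inv A ** A = B"
proof -
  have "invertible A"
    using assms by (simp add: invertible_det_nz)
  then have *: "A ** matrix_inv A = mat 1 \<and> matrix_inv A ** A = mat 1"
    unfolding invertible_def matrix_inv_def by (rule someI_ex)
  then show "matrix_inv A ** A = mat 1" "A ** matrix_inv A = mat 1" by auto
  then show "B ** A ** matrix_inv A = B" "B ** matrix_inv A ** A = B"
    by (simp_all flip: matrix_mul_assoc)
  show "det (matrix_inv A) = 1"
    using * assms by (metis det_I det_mul mult_1)
qed

lemma matrix_inv_mult_det_1:
  fixes A B :: "real ^ 'n ^ 'n"
  assumes "det A = 1" "det B = 1"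
  shows "matrix_inv (A ** B) = matrix_inv B ** matrix_inv A"
  by (rule matrix_inv_eqI) (use assms in \<open>simp add: matrix_mul_assoc matrix_inv_det_1\<close>)

definition e11 :: "real ^ 3 ^ 3" where
  "e11 = vector [vector [1, 0, 0], vector [0, 0, 0], vector [0, 0, 0]]"

text \<open>Commuting with the projection \<open>e11\<close> means preserving its image and its
  kernel, which is the block shape.\<close>

lemma GL2_iff_commute: "A \<in> GL2 \<longleftrightarrow> det A = 1 \<and> A ** e11 = e11 ** A"
  by (auto simp: GL2_def SL3_simps e11_def vec_eq_iff forall_3 matrix_matrix_mult_def sum_3)

text \<open>A point of the symmetric space is a line with a complementary plane, encoded here by the
  projection onto the line along the plane.\<close>

lemma l_coset_GL2_eq_iff:
  assumes A: "det A = 1" and B: "det B = 1"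
  shows "A <#\<^bsub>SL3\<^esub> GL2 = B <#\<^bsub>SL3\<^esub> GL2 \<longleftrightarrow> A ** e11 ** matrix_inv A = B ** e11 ** matrix_inv B"
proof
  assume eq: "A <#\<^bsub>SL3\<^esub> GL2 = B <#\<^bsub>SL3\<^esub> GL2"
  have "mat 1 \<in> GL2"
    using subgroup.one_closed[OF subgroup_GL2] by (simp add: SL3_def)
  then have "B \<in> B <#\<^bsub>SL3\<^esub> GL2"
    by (force simp: l_coset_def SL3_simps)
  then obtain h where h: "h \<in> GL2" "B = A ** h"
    unfolding eq[symmetric] by (auto simp: l_coset_def SL3_simps)
  have "B ** e11 = A ** e11 ** matrix_inv A ** B"
    using h matrix_inv_det_1[OF A] by (simp add: GL2_iff_commute matrix_mul_assoc) (simp flip: matrix_mul_assoc)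
  then show "A ** e11 ** matrix_inv A = B ** e11 ** matrix_inv B"
    using matrix_inv_det_1[OF B] by metis
next
  assume eq: "A ** e11 ** matrix_inv A = B ** e11 ** matrix_inv B"
  define h where "h = matrix_inv A ** B"
  have B': "B = A ** h"
    by (simp add: h_def matrix_mul_assoc matrix_inv_det_1[OF A])
  have "e11 ** h = matrix_inv A ** (A ** e11 ** matrix_inv A) ** B"
    by (simp add: h_def matrix_mul_assoc matrix_inv_det_1[OF A])
  also have "\<dots> = h ** e11"
    unfolding eq by (simp add: h_def matrix_mul_assoc matrix_inv_det_1[OF B])
  finally have h: "h \<in> GL2"
    by (simp add: GL2_iff_commute h_def det_mul B matrix_inv_det_1(3)[OF A])
  then have hc: "h \<in> carrier SL3" by (simp add: GL2_def)
  have "A <#\<^bsub>SL3\<^esub> GL2 = A <#\<^bsub>SL3\<^esub> (h <#\<^bsub>SL3\<^esub> GL2)"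
    using group.coset_join3[OF group_SL3 hc subgroup_GL2 h] by simp
  also have "\<dots> = (A \<otimes>\<^bsub>SL3\<^esub> h) <#\<^bsub>SL3\<^esub> GL2"
    by (rule group.lcos_m_assoc[OF group_SL3])
      (use A hc in \<open>auto simp: SL3_simps GL2_def\<close>)
  finally show "A <#\<^bsub>SL3\<^esub> GL2 = B <#\<^bsub>SL3\<^esub> GL2"
    by (simp add: B' SL3_simps)
qed

text \<open>The first coordinate of \<open>circle c t\<close> is 1/c - t/(2 c^3). Lower unipotent
  factors multiply by adding their entries, so this left factor strips off the constant 1/c and
  leaves the coordinates - l t, - l/t, 1/t, t with l = 1/(2 c^3).\<close>

definition frame :: "real \<Rightarrow> real ^ 3 ^ 3" where
  "frame c = vector [vector [1, 0, 0], vector [1 / c, 1, 0], vector [0, 0, 1]]"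

lemma det_frame [simp]: "det (frame c) = 1"
  by (simp add: frame_def det_3)

lemma matrix_inv_frame:
  "matrix_inv (frame c) = vector [vector [1, 0, 0], vector [- 1 / c, 1, 0], vector [0, 0, 1]]"
  by (rule matrix_inv_eqI)
    (simp add: frame_def vec_eq_iff forall_3 matrix_matrix_mult_def sum_3 mat_def)

text \<open>The projection onto the span of \<open>(t, - l t\<^sup>2, - l)\<close> along the kernel of
  \<open>((1 - 2 l) t, - 1, - t\<^sup>2)\<close>.\<close>

definition model_curve :: "real \<Rightarrow> real \<Rightarrow> real ^ 3 ^ 3" where
  "model_curve l t = vector
     [vector [1 - 2 * l, - 1 / t, - t],
      vector [- l * (1 - 2 * l) * t, l, l * t ^ 2],
      vector [- l * (1 - 2 * l) / t, l / t ^ 2, l]]"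

definition curve_parameter :: "real \<Rightarrow> real" where
  "curve_parameter c = 1 / (2 * c ^ 3)"

definition rep :: "real \<Rightarrow> real \<Rightarrow> real ^ 3 ^ 3" where
  "rep c t =
    (vector [vector [1, 0, 0], vector [circle c t $ 1, 1, 0], vector [circle c t $ 2, 0, 1]] :: real ^ 3 ^ 3)
      ** (vector [vector [1, circle c t $ 3, circle c t $ 4], vector [0, 1, 0], vector [0, 0, 1]] :: real ^ 3 ^ 3)"

lemma det_rep: "det (rep c t) = 1"
  by (simp add: rep_def det_mul) (simp add: det_3)

lemma rep_projection:
  assumes "c > 0" "t \<noteq> 0" "det k = 1"
  shows "(k ** rep c t) ** e11 ** matrix_inv (k ** rep c t) =
    (k ** frame c) ** model_curve (curve_parameter c) t ** matrix_inv (k ** frame c)"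
proof -
  have "rep c t ** e11 = frame c ** model_curve (curve_parameter c) t ** matrix_inv (frame c) ** rep c t"
    using assms unfolding matrix_inv_frame
    by (simp add: frame_def rep_def e11_def model_curve_def curve_parameter_def circle_def
        vec_eq_iff forall_3 matrix_matrix_mult_def sum_3 field_simps power2_eq_square power3_eq_cube)
  then have "rep c t ** e11 ** matrix_inv (rep c t) = frame c ** model_curve (curve_parameter c) t ** matrix_inv (frame c)"
    by (simp add: matrix_inv_det_1[OF det_rep])
  then show ?thesis
    using assms by (simp add: matrix_inv_mult_det_1 det_rep matrix_mul_assoc) (simp flip: matrix_mul_assoc)
qed

section \<open>Stabilizers of the circles\<close>

text \<open>The first alternative is the torus itself, the second the matrices that exchange the
  second and third axes. The normalizer is meant inside the group that preserves a conic l^2 v_1^2 =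
  v_2 v_3: a general diagonal matrix also normalizes the torus, but moves the conic. The condition
  does not involve l.\<close>

definition torus_normalizer :: "(real ^ 3 ^ 3) set" where
  "torus_normalizer = {h. h $ 1 $ 2 = 0 \<and> h $ 1 $ 3 = 0 \<and> h $ 2 $ 1 = 0 \<and> h $ 3 $ 1 = 0 \<and>
     (h $ 1 $ 1 = 1 \<and> h $ 2 $ 3 = 0 \<and> h $ 3 $ 2 = 0 \<and> h $ 2 $ 2 * h $ 3 $ 3 = 1 \<or>
      h $ 1 $ 1 = - 1 \<and> h $ 2 $ 2 = 0 \<and> h $ 3 $ 3 = 0 \<and> h $ 2 $ 3 * h $ 3 $ 2 = 1)}"

lemma det_torus_normalizer: "h \<in> torus_normalizer \<Longrightarrow> det h = 1"
  by (auto simp: torus_normalizer_def det_3)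

text \<open>The substitution is visible on the line spanned by (t, - l t^2, - l): diag(1, a, 1/a)
  sends t to a t, and the elements exchanging the axes send t to - b/t, which reverses the roles of
  the two missing points.\<close>

lemma torus_normalizer_model_curve:
  assumes h: "h \<in> torus_normalizer"
  obtains \<phi> where "bij_betw \<phi> (- {0}) (- {0})"
    and "\<And>t. t \<noteq> 0 \<Longrightarrow> h ** model_curve l t = model_curve l (\<phi> t) ** h"
  using h unfolding torus_normalizer_def mem_Collect_eq
proof (elim conjE disjE)
  assume z: "h $ 1 $ 2 = 0" "h $ 1 $ 3 = 0" "h $ 2 $ 1 = 0" "h $ 3 $ 1 = 0"
  {
    assume d: "h $ 1 $ 1 = 1" "h $ 2 $ 3 = 0" "h $ 3 $ 2 = 0" "h $ 2 $ 2 * h $ 3 $ 3 = 1"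
    define a where "a = h $ 2 $ 2"
    have "a \<noteq> 0" using d(4) by (auto simp: a_def)
    then have a: "a \<noteq> 0" "h $ 3 $ 3 = 1 / a" using d(4) by (auto simp: a_def nonzero_eq_divide_eq mult.commute)
    have "bij_betw (\<lambda>t. a * t) (- {0}) (- {0})"
      by (rule bij_betwI[where g = "\<lambda>t. t / a"]) (use a in auto)
    moreover have "h ** model_curve l t = model_curve l (a * t) ** h" if "t \<noteq> 0" for t
      using that
      by (simp add: a z d(1-3) vec_eq_iff forall_3 matrix_matrix_mult_def sum_3 model_curve_def a_def[symmetric]
          field_simps power2_eq_square)
    ultimately show thesis by (rule that)
  }
  {
    assume d: "h $ 1 $ 1 = - 1" "h $ 2 $ 2 = 0" "h $ 3 $ 3 = 0" "h $ 2 $ 3 * h $ 3 $ 2 = 1"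
    define b where "b = h $ 2 $ 3"
    have "b \<noteq> 0" using d(4) by (auto simp: b_def)
    then have b: "b \<noteq> 0" "h $ 3 $ 2 = 1 / b" using d(4) by (auto simp: b_def nonzero_eq_divide_eq mult.commute)
    have "bij_betw (\<lambda>t. - b / t) (- {0}) (- {0})"
      by (rule bij_betwI[where g = "\<lambda>t. - b / t"]) (use b in auto)
    moreover have "h ** model_curve l t = model_curve l (- b / t) ** h" if "t \<noteq> 0" for t
      using that
      by (simp add: b z d(1-3) vec_eq_iff forall_3 matrix_matrix_mult_def sum_3 model_curve_def b_def[symmetric]
          field_simps power2_eq_square)
    ultimately show thesis by (rule that)
  }
qed

lemma cube_eq_1:
  fixes x :: real
  assumes "x ^ 3 = 1"
  shows "x = 1"
proof -
  \<comment> \<open>The second factor is 4 (x^2 + x + 1) with the square completed.\<close>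
  have "(x - 1) * ((2 * x + 1) ^ 2 + 3) = 0"
    using assms by (simp add: algebra_simps power2_eq_square power3_eq_cube)
  moreover have "(2 * x + 1) ^ 2 + 3 > 0"
    by (simp add: add_nonneg_pos)
  ultimately show ?thesis by simp
qed

lemma quartic_eq_0_coeffs:
  fixes a b c d e :: real
  assumes "\<And>t. t \<noteq> 0 \<Longrightarrow> a + b * t + c * t ^ 2 + d * t ^ 3 + e * t ^ 4 = 0"
  shows "a = 0" "b = 0" "c = 0" "d = 0" "e = 0"
  using assms[of 1] assms[of "- 1"] assms[of 2] assms[of "- 2"] assms[of 3] by simp_all

text \<open>The images of the projections \<open>model_curve l t\<close> are the points of a conic, except for
  the two points spanned by the second and the third basis vector.\<close>

definition conic_point :: "real \<Rightarrow> real \<Rightarrow> real ^ 3" where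
  "conic_point l t = vector [t, - l * t ^ 2, - l]"

lemma conic_point_image:
  assumes h: "det h = 1" and "l > 0" "t \<noteq> 0" "s \<noteq> 0"
    and eq: "h ** model_curve l t = model_curve l' s ** h"
  obtains m where "m \<noteq> 0" "h *v conic_point l t = m *\<^sub>R conic_point l' s"
proof -
  have fixed: "model_curve l t *v conic_point l t = conic_point l t"
    using \<open>t \<noteq> 0\<close> by (simp add: vec_eq_iff forall_3 matrix_vector_mult_def sum_3 model_curve_def
        conic_point_def field_simps power2_eq_square)
  define v where "v = h *v conic_point l t"
  \<comment> \<open>\<open>model_curve l' s\<close> has rank one: it is
    \<open>conic_point l' s\<close> times the covector ((1 - 2 l') s, - 1, - s^2) / s^2, and
    \<open>m\<close> is the value of that covector on \<open>v\<close>.\<close>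
  define m where "m = ((1 - 2 * l') * s * v $ 1 - v $ 2 - s ^ 2 * v $ 3) / s ^ 2"
  have "v = model_curve l' s *v v"
    unfolding v_def by (metis eq fixed matrix_vector_mul_assoc)
  also have "\<dots> = m *\<^sub>R conic_point l' s"
    using \<open>s \<noteq> 0\<close> by (simp add: vec_eq_iff forall_3 matrix_vector_mult_def sum_3 model_curve_def m_def
        conic_point_def field_simps power2_eq_square)
  finally have v: "v = m *\<^sub>R conic_point l' s" .
  have "conic_point l t = matrix_inv h *v v"
    by (simp add: v_def matrix_vector_mul_assoc matrix_inv_det_1[OF h])
  moreover have "conic_point l t \<noteq> 0"
    using \<open>t \<noteq> 0\<close> by (auto simp: conic_point_def vec_eq_iff forall_3)
  ultimately have "m \<noteq> 0" using v by auto
  then show thesis using v unfolding v_def by (rule that)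
qed

text \<open>The entry of the projections at (1, 1), which is constant along the curve and preserved by
  \<open>h\<close>, recovers the parameter \<open>l\<close>.\<close>

lemma model_curve_stabilizer:
  assumes h: "det h = 1" and l: "l > 0" "l' > 0"
    and 1: "\<And>t. t \<noteq> 0 \<Longrightarrow> \<exists>s. s \<noteq> 0 \<and> h ** model_curve l t = model_curve l' s ** h"
    and 2: "\<And>s. s \<noteq> 0 \<Longrightarrow> \<exists>t. t \<noteq> 0 \<and> h ** model_curve l t = model_curve l' s ** h"
  shows "h \<in> torus_normalizer \<and> l = l'"
proof -
  have conic: "l' ^ 2 * (v $ 1) ^ 2 = v $ 2 * v $ 3" if v: "v = h *v conic_point l t" and t: "t \<noteq> 0" for t v
  proof -
    obtain s where s: "s \<noteq> 0" "h ** model_curve l t = model_curve l' s ** h" using 1[OF t] by (elim exE conjE)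
    obtain m where "v = m *\<^sub>R conic_point l' s"
      using conic_point_image[OF h l(1) t s] v by metis
    then show ?thesis by (simp add: conic_point_def power2_eq_square)
  qed
  \<comment> \<open>The equation of the target conic at \<open>h *v conic_point l t\<close>, sorted
    by powers of \<open>t\<close>. Its constant and leading coefficients say that the images of the
    third and the second axis lie on that conic.\<close>
  have q: "(l' ^ 2 * l ^ 2 * (h $ 1 $ 3) ^ 2 - l ^ 2 * h $ 2 $ 3 * h $ 3 $ 3)
      + (- 2 * l' ^ 2 * l * h $ 1 $ 1 * h $ 1 $ 3 + l * (h $ 2 $ 1 * h $ 3 $ 3 + h $ 2 $ 3 * h $ 3 $ 1)) * t
      + (l' ^ 2 * ((h $ 1 $ 1) ^ 2 + 2 * l ^ 2 * h $ 1 $ 2 * h $ 1 $ 3) - h $ 2 $ 1 * h $ 3 $ 1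
           - l ^ 2 * (h $ 2 $ 2 * h $ 3 $ 3 + h $ 2 $ 3 * h $ 3 $ 2)) * t ^ 2
      + (- 2 * l' ^ 2 * l * h $ 1 $ 1 * h $ 1 $ 2 + l * (h $ 2 $ 1 * h $ 3 $ 2 + h $ 2 $ 2 * h $ 3 $ 1)) * t ^ 3
      + (l' ^ 2 * l ^ 2 * (h $ 1 $ 2) ^ 2 - l ^ 2 * h $ 2 $ 2 * h $ 3 $ 2) * t ^ 4 = 0" if "t \<noteq> 0" for t
    using conic[OF refl that]
    by (simp add: matrix_vector_mult_def sum_3 conic_point_def algebra_simps power2_eq_square
        power3_eq_cube power4_eq_xxxx)
  note q = quartic_eq_0_coeffs[OF q]
  \<comment> \<open>A point of the target conic with nonzero first coordinate lies on the target
    curve, so by \<open>2\<close> it is the image of some \<open>conic_point l t\<close>. As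
    \<open>h\<close> is injective, \<open>w\<close> would be proportional to that point, whose first
    coordinate \<open>t\<close> is nonzero.\<close>
  have no: "u $ 1 = 0" if u: "l' ^ 2 * (u $ 1) ^ 2 = u $ 2 * u $ 3" "u = h *v w" "w $ 1 = 0" for u w
  proof (rule ccontr)
    assume "u $ 1 \<noteq> 0"
    then have nz: "u $ 2 \<noteq> 0" "u $ 3 \<noteq> 0" using u(1) l by auto
    define s where "s = - l' * u $ 1 / u $ 3"
    have s: "s \<noteq> 0" using \<open>u $ 1 \<noteq> 0\<close> nz l by (simp add: s_def)
    have us: "conic_point l' s = (- l' / u $ 3) *\<^sub>R u"
      using nz l u(1)
      by (simp add: vec_eq_iff forall_3 conic_point_def s_def field_simps power2_eq_square)
    obtain t where t: "t \<noteq> 0" "h ** model_curve l t = model_curve l' s ** h" using 2[OF s] by (elim exE conjE)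
    obtain m where m: "m \<noteq> 0" "h *v conic_point l t = m *\<^sub>R conic_point l' s"
      using conic_point_image[OF h l(1) t(1) s t(2)] by metis
    have "h *v conic_point l t = (- m * l' / u $ 3) *\<^sub>R u"
      by (simp add: m us)
    then have "h *v conic_point l t = h *v ((- m * l' / u $ 3) *\<^sub>R w)"
      by (simp only: u(2) matrix_vector_mult_scaleR)
    then have "conic_point l t = (- m * l' / u $ 3) *\<^sub>R w"
      by (metis h matrix_inv_det_1(1) matrix_vector_mul_assoc matrix_vector_mul_lid)
    then have "conic_point l t $ 1 = 0" using u(3) by simp
    then show False using t by (simp add: conic_point_def)
  qed
  \<comment> \<open>So \<open>h\<close> permutes the two points of the conic that are missing from the curve.\<close>
  have 13: "h $ 1 $ 3 = 0"
    using no[of "h *v axis 3 1" "axis 3 1"] q(1) l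
    by (auto simp: matrix_vector_mult_def sum_3 axis_def power2_eq_square)
  have 12: "h $ 1 $ 2 = 0"
    using no[of "h *v axis 2 1" "axis 2 1"] q(5) l
    by (auto simp: matrix_vector_mult_def sum_3 axis_def power2_eq_square)
  have det: "h $ 1 $ 1 * (h $ 2 $ 2 * h $ 3 $ 3 - h $ 2 $ 3 * h $ 3 $ 2) = 1"
    using h 12 13 by (simp add: det_3 algebra_simps)
  \<comment> \<open>As the lower block is invertible, \<open>p\<close> makes it diagonal or
    antidiagonal; then \<open>r\<close> forces the remaining entries of the first column to
    vanish.\<close>
  have p: "h $ 2 $ 3 * h $ 3 $ 3 = 0" "h $ 2 $ 2 * h $ 3 $ 2 = 0"
    using q(1,5) 12 13 l by auto
  have r: "h $ 2 $ 1 * h $ 3 $ 3 + h $ 2 $ 3 * h $ 3 $ 1 = 0" "h $ 2 $ 1 * h $ 3 $ 2 + h $ 2 $ 2 * h $ 3 $ 1 = 0"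
    using q(2,4) 12 13 l by auto
  have 21: "h $ 2 $ 1 = 0" "h $ 3 $ 1 = 0" using p r det by auto
  have ll: "l = l'"
  proof -
    obtain s where "h ** model_curve l 1 = model_curve l' s ** h"
      using 1[OF zero_neq_one[symmetric]] by (elim exE conjE)
    then have "(h ** model_curve l 1) $ 1 $ 1 = (model_curve l' s ** h) $ 1 $ 1" by simp
    then have "h $ 1 $ 1 * (1 - 2 * l) = h $ 1 $ 1 * (1 - 2 * l')"
      by (simp add: matrix_matrix_mult_def sum_3 model_curve_def 12 13 21)
    then show ?thesis using det by auto
  qed
  \<comment> \<open>The coefficient of t^2. Together with the determinant it gives h_11^3 = 1 for a
    diagonal block and h_11^3 = - 1 for an antidiagonal one.\<close>
  have sq: "(h $ 1 $ 1) ^ 2 = h $ 2 $ 2 * h $ 3 $ 3 + h $ 2 $ 3 * h $ 3 $ 2"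
  proof -
    have "l ^ 2 * ((h $ 1 $ 1) ^ 2 - (h $ 2 $ 2 * h $ 3 $ 3 + h $ 2 $ 3 * h $ 3 $ 2)) = 0"
      using q(3) by (simp add: 12 13 21 ll algebra_simps)
    then show ?thesis using l by simp
  qed
  have "h \<in> torus_normalizer"
  proof (cases "h $ 2 $ 3 = 0")
    case True
    then have "h $ 3 $ 2 = 0" using p det by auto
    then have "(h $ 1 $ 1) ^ 3 = 1"
      using det sq True by (simp add: power2_eq_square power3_eq_cube mult_ac)
    then have "h $ 1 $ 1 = 1" by (rule cube_eq_1)
    then show ?thesis
      using True \<open>h $ 3 $ 2 = 0\<close> 12 13 21 det by (simp add: torus_normalizer_def)
  next
    case False
    then have *: "h $ 3 $ 3 = 0" "h $ 2 $ 2 = 0" using p det by auto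
    then have "(- h $ 1 $ 1) ^ 3 = 1"
      using det sq by (simp add: power2_eq_square power3_eq_cube mult_ac)
    then have "h $ 1 $ 1 = - 1" using cube_eq_1[of "- h $ 1 $ 1"] by simp
    then show ?thesis
      using * 12 13 21 det by (simp add: torus_normalizer_def)
  qed
  with ll show ?thesis by blast
qed

section \<open>Equality of translated circles\<close>

lemma translate_curve_circle:
  assumes "det k = 1"
  shows "translate_curve k (circle_curve c) = (\<lambda>t. (k ** rep c t) <#\<^bsub>SL3\<^esub> GL2) ` (- {0})"
proof -
  have "k <#\<^bsub>SL3\<^esub> exp_coords (circle c t) = (k ** rep c t) <#\<^bsub>SL3\<^esub> GL2" for t
    using group.lcos_m_assoc[OF group_SL3 subgroup.subset[OF subgroup_GL2], of k "rep c t"] assms det_rep[of c t]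
    unfolding exp_coords_def rep_def[symmetric] by (simp add: SL3_simps)
  then show ?thesis
    unfolding translate_curve_def circle_curve_def by (force simp: image_iff)
qed

lemma conj_eq_iff:
  fixes g g' p p' :: "real ^ 'n ^ 'n"
  assumes "det g = 1" "det g' = 1"
  shows "g ** p ** matrix_inv g = g' ** p' ** matrix_inv g' \<longleftrightarrow>
    (matrix_inv g ** g') ** p' = p ** (matrix_inv g ** g')"
proof
  assume "g ** p ** matrix_inv g = g' ** p' ** matrix_inv g'"
  then have "matrix_inv g ** (g ** p ** matrix_inv g) ** g' = matrix_inv g ** (g' ** p' ** matrix_inv g') ** g'"
    by simp
  then show "(matrix_inv g ** g') ** p' = p ** (matrix_inv g ** g')"
    by (simp add: matrix_mul_assoc matrix_inv_det_1 assms)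
next
  assume "(matrix_inv g ** g') ** p' = p ** (matrix_inv g ** g')"
  then have "g ** ((matrix_inv g ** g') ** p') ** matrix_inv g' = g ** (p ** (matrix_inv g ** g')) ** matrix_inv g'"
    by simp
  then show "g ** p ** matrix_inv g = g' ** p' ** matrix_inv g'"
    by (simp add: matrix_mul_assoc matrix_inv_det_1 assms)
qed

lemma curve_parameter_inject:
  assumes "c > 0" "c' > 0"
  shows "curve_parameter c = curve_parameter c' \<longleftrightarrow> c = c'"
  using assms power_eq_imp_eq_base[of c 3 c'] by (auto simp: curve_parameter_def)

text \<open>The fibres of the parametrization: in terms of the frames \<open>k ** frame c\<close>
  they are right cosets of orbits under one fixed group, that is, the sets g N with N =
  \<open>torus_normalizer\<close>, separately for each \<open>c\<close>.\<close>

lemma translate_circle_curve_eq_iff: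
  assumes c: "c > 0" "c' > 0" and k: "det k = 1" "det k' = 1"
  shows "translate_curve k (circle_curve c) = translate_curve k' (circle_curve c') \<longleftrightarrow>
    c = c' \<and> (\<exists>n\<in>torus_normalizer. k' ** frame c' = k ** frame c ** n)"
proof -
  let ?l = "curve_parameter c" and ?l' = "curve_parameter c'"
  define g g' where "g = k ** frame c" and "g' = k' ** frame c'"
  have g: "det g = 1" "det g' = 1" using k by (auto simp: g_def g'_def det_mul)
  define h where "h = matrix_inv g ** g'"
  have h: "det h = 1" by (simp add: h_def det_mul g matrix_inv_det_1)
  have gh: "g' = g ** n \<longleftrightarrow> h = n" for n
    unfolding h_def by (metis g(1) matrix_inv_det_1(1,2) matrix_mul_assoc matrix_mul_lid)
  have pt: "(k ** rep c t) <#\<^bsub>SL3\<^esub> GL2 = (k' ** rep c' s) <#\<^bsub>SL3\<^esub> GL2 \<longleftrightarrow>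
      h ** model_curve ?l' s = model_curve ?l t ** h" if "t \<noteq> 0" "s \<noteq> 0" for t s
  proof -
    have "(k ** rep c t) <#\<^bsub>SL3\<^esub> GL2 = (k' ** rep c' s) <#\<^bsub>SL3\<^esub> GL2 \<longleftrightarrow>
      (k ** rep c t) ** e11 ** matrix_inv (k ** rep c t) = (k' ** rep c' s) ** e11 ** matrix_inv (k' ** rep c' s)"
      by (rule l_coset_GL2_eq_iff) (simp_all add: det_mul k det_rep)
    also have "\<dots> \<longleftrightarrow> h ** model_curve ?l' s = model_curve ?l t ** h"
      unfolding rep_projection[OF c(1) that(1) k(1)] rep_projection[OF c(2) that(2) k(2)]
        g_def[symmetric] g'_def[symmetric] h_def by (rule conj_eq_iff[OF g])
    finally show ?thesis .
  qed
  have "translate_curve k (circle_curve c) = translate_curve k' (circle_curve c') \<longleftrightarrow>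
    (\<forall>s. s \<noteq> 0 \<longrightarrow> (\<exists>t. t \<noteq> 0 \<and> h ** model_curve ?l' s = model_curve ?l t ** h)) \<and>
    (\<forall>t. t \<noteq> 0 \<longrightarrow> (\<exists>s. s \<noteq> 0 \<and> h ** model_curve ?l' s = model_curve ?l t ** h))" (is "_ \<longleftrightarrow> ?R")
  proof -
    have im: "F ` X = G ` X \<longleftrightarrow> (\<forall>s\<in>X. \<exists>t\<in>X. F t = G s) \<and> (\<forall>t\<in>X. \<exists>s\<in>X. F t = G s)"
      for F G :: "real \<Rightarrow> (real ^ 3 ^ 3) set" and X
      by (auto simp: set_eq_iff image_iff) metis+
    show ?thesis
      unfolding translate_curve_circle[OF k(1)] translate_curve_circle[OF k(2)] im
      by (simp add: Ball_def Bex_def pt cong: conj_cong imp_cong)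
  qed
  also have "\<dots> \<longleftrightarrow> c = c' \<and> h \<in> torus_normalizer"
  proof
    assume R: ?R
    have "h \<in> torus_normalizer \<and> ?l' = ?l"
    proof (rule model_curve_stabilizer[OF h])
      show "?l' > 0" "?l > 0" using c by (simp_all add: curve_parameter_def)
    qed (use R in \<open>blast+\<close>)
    then show "c = c' \<and> h \<in> torus_normalizer"
      using curve_parameter_inject[OF c] by simp
  next
    assume *: "c = c' \<and> h \<in> torus_normalizer"
    then obtain \<phi> where \<phi>: "bij_betw \<phi> (- {0}) (- {0})"
      "\<And>t. t \<noteq> 0 \<Longrightarrow> h ** model_curve ?l t = model_curve ?l (\<phi> t) ** h"
      using torus_normalizer_model_curve by blast
    have "\<phi> s \<noteq> 0" if "s \<noteq> 0" for s
      using bij_betwE[OF \<phi>(1)] that by simp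
    moreover have "\<exists>s. s \<noteq> 0 \<and> \<phi> s = t" if "t \<noteq> 0" for t
      using bij_betw_imp_surj_on[OF \<phi>(1)] that by (metis Compl_iff image_iff singleton_iff)
    ultimately show ?R
      using * \<phi>(2) by metis
  qed
  also have "\<dots> \<longleftrightarrow> c = c' \<and> (\<exists>n\<in>torus_normalizer. k' ** frame c' = k ** frame c ** n)"
    using gh by (auto simp: g_def g'_def)
  finally show ?thesis .
qed

section \<open>General topology of charts and quotient maps\<close>

lemma topological_manifoldI:
  assumes "Hausdorff_space X" "second_countable X"
    and chart: "\<And>x. x \<in> topspace X \<Longrightarrow> \<exists>V f. openin (Euclidean_space n) V \<and>
      continuous_map (subtopology (Euclidean_space n) V) X f \<and>
      open_map (subtopology (Euclidean_space n) V) X f \<and> inj_on f V \<and> x \<in> f ` V"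
  shows "topological_manifold n X"
  unfolding topological_manifold_def
proof (intro conjI ballI assms(1,2))
  fix x assume "x \<in> topspace X"
  then obtain V f where V: "openin (Euclidean_space n) V"
    and f: "continuous_map (subtopology (Euclidean_space n) V) X f"
      "open_map (subtopology (Euclidean_space n) V) X f" "inj_on f V" "x \<in> f ` V"
    using chart by blast
  have top: "topspace (subtopology (Euclidean_space n) V) = V"
    using openin_subset[OF V] by auto
  \<comment> \<open>Openness of \<open>f\<close> makes its image an open neighbourhood and also
    supplies the continuity of the inverse, so a chart can be given as a parametrization.\<close>
  have U: "openin X (f ` V)"
    using f(2) V unfolding open_map_def by (metis openin_topspace top)
  have "homeomorphic_map (subtopology (Euclidean_space n) V) (subtopology X (f ` V)) f"
  proof (rule bijective_open_imp_homeomorphic_map)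
    show "continuous_map (subtopology (Euclidean_space n) V) (subtopology X (f ` V)) f"
      by (rule continuous_map_into_subtopology[OF f(1)]) (simp add: top)
    show "open_map (subtopology (Euclidean_space n) V) (subtopology X (f ` V)) f"
      using f(2) openin_subset[of "subtopology (Euclidean_space n) V"] unfolding open_map_def top
      by (meson U image_mono openin_open_subtopology)
    show "f ` topspace (subtopology (Euclidean_space n) V) = topspace (subtopology X (f ` V))"
      using openin_subset[OF U] unfolding top by auto
    show "inj_on f (topspace (subtopology (Euclidean_space n) V))"
      unfolding top by (rule f(3))
  qed
  then have "subtopology X (f ` V) homeomorphic_space subtopology (Euclidean_space n) V"
    using homeomorphic_map_imp_homeomorphic_space homeomorphic_space_sym by blast
  then show "\<exists>U V. openin X U \<and> x \<in> U \<and> openin (Euclidean_space n) V \<and>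
        subtopology X U homeomorphic_space subtopology (Euclidean_space n) V"
    using U V f(4) by blast
qed

lemma quotient_topology_exists:
  obtains N where "quotient_map X N f" "topspace N = f ` topspace X"
proof -
  \<comment> \<open>The final topology of \<open>f\<close> on its image.\<close>
  define P where "P U \<longleftrightarrow> U \<subseteq> f ` topspace X \<and> openin X {x \<in> topspace X. f x \<in> U}" for U
  have "istopology P"
    unfolding istopology_def
  proof (intro conjI allI impI)
    fix S T assume "P S" "P T"
    moreover have "{x \<in> topspace X. f x \<in> S \<inter> T} = {x \<in> topspace X. f x \<in> S} \<inter> {x \<in> topspace X. f x \<in> T}"
      by auto
    ultimately show "P (S \<inter> T)" unfolding P_def by (auto intro: openin_Int)
  next
    fix \<K> assume \<K>: "\<forall>K\<in>\<K>. P K"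
    have "{x \<in> topspace X. f x \<in> \<Union> \<K>} = (\<Union>K\<in>\<K>. {x \<in> topspace X. f x \<in> K})" by auto
    also have "openin X \<dots>" using \<K> unfolding P_def by (intro openin_Union) auto
    finally show "P (\<Union> \<K>)" using \<K> unfolding P_def by blast
  qed
  then have op: "openin (topology P) U \<longleftrightarrow> P U" for U
    by (simp add: topology_inverse')
  have "P (f ` topspace X)"
  proof -
    have "{x \<in> topspace X. f x \<in> f ` topspace X} = topspace X" by auto
    then show ?thesis by (simp add: P_def)
  qed
  then have top: "topspace (topology P) = f ` topspace X"
    using op openin_topspace[of "topology P"] openin_subset[of "topology P" "f ` topspace X"]
    by (auto simp: P_def)
  have "quotient_map X (topology P) f"
    unfolding quotient_map_def top op P_def by auto
  then show thesis using top that by blast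
qed

lemma quotient_map_imp_open_map:
  assumes "quotient_map X N f"
    and "\<And>U. openin X U \<Longrightarrow> openin X {x \<in> topspace X. f x \<in> f ` U}"
  shows "open_map X N f"
  unfolding open_map_def
proof (intro allI impI)
  fix U assume U: "openin X U"
  then have "f ` U \<subseteq> topspace N"
    using openin_subset[OF U] assms(1) unfolding quotient_map_def by auto
  then show "openin N (f ` U)"
    using assms U unfolding quotient_map_def by blast
qed

section \<open>The manifold of translated circles\<close>

lemma second_countable_euclidean: "second_countable (euclidean :: 'a::second_countable_topology topology)"
proof -
  obtain B :: "'a set set" where B: "countable B" "\<And>C. C \<in> B \<Longrightarrow> open C"
    "\<And>S. open S \<Longrightarrow> \<exists>U. U \<subseteq> B \<and> S = \<Union>U"
    using univ_second_countable by metis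
  have "\<exists>V\<in>B. x \<in> V \<and> V \<subseteq> U" if "open U" "x \<in> U" for U x
    using B(3)[OF that(1)] that(2) by blast
  with B(1,2) show ?thesis
    unfolding second_countable_def by (auto intro!: exI[of _ B])
qed

lemma continuous_on_matrix_matrix_mult [continuous_intros]:
  fixes f :: "'a::topological_space \<Rightarrow> real ^ 'n ^ 'm" and g :: "'a \<Rightarrow> real ^ 'p ^ 'n"
  shows "continuous_on S f \<Longrightarrow> continuous_on S g \<Longrightarrow> continuous_on S (\<lambda>x. f x ** g x)"
  unfolding matrix_matrix_mult_def by (intro continuous_intros)

lemma continuous_on_transpose [continuous_intros]:
  fixes f :: "'a::topological_space \<Rightarrow> real ^ 'n ^ 'm"
  shows "continuous_on S f \<Longrightarrow> continuous_on S (\<lambda>x. transpose (f x))"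
  unfolding transpose_def by (intro continuous_intros)

lemma continuous_on_vector_3 [continuous_intros]:
  fixes f g h :: "'a::topological_space \<Rightarrow> 'b::{zero,topological_space}"
  assumes "continuous_on S f" "continuous_on S g" "continuous_on S h"
  shows "continuous_on S (\<lambda>x. vector [f x, g x, h x] :: 'b ^ 3)"
proof -
  have eq: "(\<lambda>x. vector [f x, g x, h x] :: 'b ^ 3) =
      (\<lambda>x. \<chi> i. if i = 1 then f x else if i = 2 then g x else h x)"
    by (simp add: fun_eq_iff vec_eq_iff forall_3)
  show ?thesis
    unfolding eq
  proof (rule continuous_on_vec_lambda)
    show "continuous_on S (\<lambda>x. if i = 1 then f x else if i = 2 then g x else h x)" for i :: 3
      by (cases "i = 1"; cases "i = 2") (simp_all add: assms)
  qed
qed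

definition e23 :: "real ^ 3 ^ 3" where
  "e23 = vector [vector [0, 0, 0], vector [0, 0, 1], vector [0, 1, 0]]"

text \<open>These two tensors separate the cosets of the stabilizer by continuous functions, which makes
  the orbits Hausdorff.\<close>

lemma torus_normalizer_iff:
  "n \<in> torus_normalizer \<longleftrightarrow> det n = 1 \<and> n ** e11 ** transpose n = e11 \<and> n ** e23 ** transpose n = e23"
proof
  assume "n \<in> torus_normalizer"
  then show "det n = 1 \<and> n ** e11 ** transpose n = e11 \<and> n ** e23 ** transpose n = e23"
    by (auto simp: torus_normalizer_def det_3 e11_def e23_def vec_eq_iff forall_3
        matrix_matrix_mult_def sum_3 transpose_def mult.commute)
next
  assume n: "det n = 1 \<and> n ** e11 ** transpose n = e11 \<and> n ** e23 ** transpose n = e23"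
  then have 1: "n $ 1 $ 1 * n $ 1 $ 1 = 1" "n $ 2 $ 1 = 0" "n $ 3 $ 1 = 0"
    and 2: "n $ 1 $ 2 * n $ 1 $ 3 = 0" "n $ 2 $ 2 * n $ 2 $ 3 = 0" "n $ 3 $ 2 * n $ 3 $ 3 = 0"
      "n $ 1 $ 3 * n $ 2 $ 2 + n $ 1 $ 2 * n $ 2 $ 3 = 0"
      "n $ 1 $ 3 * n $ 3 $ 2 + n $ 1 $ 2 * n $ 3 $ 3 = 0"
      "n $ 2 $ 3 * n $ 3 $ 2 + n $ 2 $ 2 * n $ 3 $ 3 = 1"
    by (simp_all add: e11_def e23_def vec_eq_iff forall_3 matrix_matrix_mult_def sum_3 transpose_def)
  from n have d: "n $ 1 $ 1 * (n $ 2 $ 2 * n $ 3 $ 3 - n $ 2 $ 3 * n $ 3 $ 2) = 1"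
    using 1 by (simp add: det_3 algebra_simps)
  show "n \<in> torus_normalizer"
  proof (cases "n $ 2 $ 2 = 0")
    case True
    then have "n $ 2 $ 3 * n $ 3 $ 2 = 1" "n $ 2 $ 3 \<noteq> 0" "n $ 3 $ 2 \<noteq> 0" using 2(6) by auto
    moreover from this have "n $ 3 $ 3 = 0" "n $ 1 $ 2 = 0" "n $ 1 $ 3 = 0"
      using 2 True by auto
    ultimately show ?thesis
      using 1 d True by (simp add: torus_normalizer_def)
  next
    case False
    then have z: "n $ 2 $ 3 = 0" using 2(2) by simp
    then have "n $ 2 $ 2 * n $ 3 $ 3 = 1" "n $ 3 $ 3 \<noteq> 0" using 2(6) by auto
    moreover from this have "n $ 3 $ 2 = 0" "n $ 1 $ 2 = 0" "n $ 1 $ 3 = 0"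
      using 2 False z by auto
    ultimately show ?thesis
      using 1 d z by (simp add: torus_normalizer_def)
  qed
qed

text \<open>Near the identity, the torus \<open>diag(1, s, 1 / s)\<close> acting from the right is used to make
  the (2, 2) entry 1, and the (1, 1) entry is determined by the others through the determinant.\<close>

definition normal_form :: "(nat \<Rightarrow> real) \<Rightarrow> real ^ 3 ^ 3" where
  "normal_form v = vector
     [vector [(1 + v 0 * (v 5 * v 4 - v 3 * v 6) - v 2 * (v 5 * v 1 - v 6)) / (v 4 - v 3 * v 1), v 0, v 2],
      vector [v 5, 1, v 3],
      vector [v 6, v 1, v 4]]"

text \<open>Right multiplication by diag(1, s, 1/s) scales the second and third columns by inverse
  factors. Quotients within the second column and products of the third column with the (2, 2) entry
  are therefore invariant under the torus.\<close>

definition normal_coords :: "real ^ 3 ^ 3 \<Rightarrow> real \<Rightarrow> nat \<Rightarrow> real" where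
  "normal_coords g c i =
     (if i = 0 then g $ 1 $ 2 / g $ 2 $ 2 else if i = 1 then g $ 3 $ 2 / g $ 2 $ 2
      else if i = 2 then g $ 1 $ 3 * g $ 2 $ 2 else if i = 3 then g $ 2 $ 3 * g $ 2 $ 2
      else if i = 4 then g $ 3 $ 3 * g $ 2 $ 2 else if i = 5 then g $ 2 $ 1
      else if i = 6 then g $ 3 $ 1 else if i = 7 then c else 0)"

text \<open>The inequality keeps the denominator in \<open>normal_form\<close> away from 0 and
  admits only one of the two torus cosets in the normalizer. Points of
  \<open>Euclidean_space 8\<close> are sequences vanishing from index 8 on; index 7 holds the
  parameter \<open>c\<close>.\<close>

definition chart_domain :: "(nat \<Rightarrow> real) set" where
  "chart_domain = {v. (\<forall>i\<ge>8. v i = 0) \<and> v 7 > 0 \<and> \<bar>v 1 * v 3\<bar> < \<bar>v 4\<bar>}"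

definition orbit_chart_domain :: "(nat \<Rightarrow> real) set" where
  "orbit_chart_domain = {v. (\<forall>i\<ge>7. v i = 0) \<and> \<bar>v 1 * v 3\<bar> < \<bar>v 4\<bar>}"

lemma det_normal_form:
  assumes "\<bar>v 1 * v 3\<bar> < \<bar>v 4\<bar>"
  shows "det (normal_form v) = 1"
proof -
  define x where "x = (1 + v 0 * (v 5 * v 4 - v 3 * v 6) - v 2 * (v 5 * v 1 - v 6)) / (v 4 - v 3 * v 1)"
  have "v 4 - v 3 * v 1 \<noteq> 0" using assms by (auto simp: mult.commute)
  then have "x * (v 4 - v 3 * v 1) = 1 + v 0 * (v 5 * v 4 - v 3 * v 6) - v 2 * (v 5 * v 1 - v 6)"
    by (simp add: x_def)
  then show ?thesis
    unfolding normal_form_def x_def[symmetric] by (simp add: det_3 algebra_simps)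
qed

lemma normal_form_normal_coords:
  assumes g: "det g = 1" "\<bar>g $ 3 $ 2 * g $ 2 $ 3\<bar> < \<bar>g $ 3 $ 3 * g $ 2 $ 2\<bar>"
  obtains n where "n \<in> torus_normalizer" "normal_form (normal_coords g c) = g ** n"
proof
  let ?n = "vector [vector [1, 0, 0], vector [0, 1 / g $ 2 $ 2, 0], vector [0, 0, g $ 2 $ 2]] :: real ^ 3 ^ 3"
  have nz: "g $ 2 $ 2 \<noteq> 0" using g(2) by auto
  then show "?n \<in> torus_normalizer" by (simp add: torus_normalizer_def)
  have d: "g $ 3 $ 3 * g $ 2 $ 2 - g $ 2 $ 3 * g $ 3 $ 2 \<noteq> 0" using g(2) by (auto simp: mult.commute)
  \<comment> \<open>The numerator of the (1, 1) entry of the normal form. The scalings by the (2, 2)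
    entry cancel, and expanding the determinant along the first row leaves g_11 times its
    minor.\<close>
  have "(1 + g $ 1 $ 2 / g $ 2 $ 2 * (g $ 2 $ 1 * (g $ 3 $ 3 * g $ 2 $ 2) - g $ 2 $ 3 * g $ 2 $ 2 * g $ 3 $ 1)
      - g $ 1 $ 3 * g $ 2 $ 2 * (g $ 2 $ 1 * (g $ 3 $ 2 / g $ 2 $ 2) - g $ 3 $ 1))
    = 1 + g $ 1 $ 2 * (g $ 2 $ 1 * g $ 3 $ 3 - g $ 2 $ 3 * g $ 3 $ 1)
      - g $ 1 $ 3 * (g $ 2 $ 1 * g $ 3 $ 2 - g $ 2 $ 2 * g $ 3 $ 1)"
    using nz by (simp add: field_simps)
  also have "\<dots> = g $ 1 $ 1 * (g $ 3 $ 3 * g $ 2 $ 2 - g $ 2 $ 3 * g $ 3 $ 2)"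
    using g(1) by (simp add: det_3 algebra_simps)
  finally have "normal_form (normal_coords g c) $ 1 $ 1 = g $ 1 $ 1"
    using nz d by (simp add: normal_form_def normal_coords_def)
  moreover have "normal_form (normal_coords g c) $ 1 $ 2 = g $ 1 $ 2 / g $ 2 $ 2"
    "normal_form (normal_coords g c) $ 1 $ 3 = g $ 1 $ 3 * g $ 2 $ 2"
    "normal_form (normal_coords g c) $ 2 = vector [g $ 2 $ 1, 1, g $ 2 $ 3 * g $ 2 $ 2]"
    "normal_form (normal_coords g c) $ 3 = vector [g $ 3 $ 1, g $ 3 $ 2 / g $ 2 $ 2, g $ 3 $ 3 * g $ 2 $ 2]"
    by (simp_all add: normal_form_def normal_coords_def)
  ultimately show "normal_form (normal_coords g c) = g ** ?n"
    using nz by (simp add: vec_eq_iff forall_3 matrix_matrix_mult_def sum_3)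
qed

text \<open>The elements of the normalizer outside the torus exchange the last two columns up to scaling, which
  reverses the inequality \<open>\<bar>v\<^sub>1 v\<^sub>3\<bar> < \<bar>v\<^sub>4\<bar>\<close>.\<close>

lemma normal_form_inject:
  assumes v: "\<bar>v 1 * v 3\<bar> < \<bar>v 4\<bar>" "\<bar>v' 1 * v' 3\<bar> < \<bar>v' 4\<bar>"
    and n: "n \<in> torus_normalizer" "normal_form v' = normal_form v ** n"
  shows "\<forall>i<7. v i = v' i"
proof -
  have e: "normal_form v' $ i $ j = (normal_form v ** n) $ i $ j" for i j using n(2) by simp
  have z: "n $ 1 $ 2 = 0" "n $ 1 $ 3 = 0" "n $ 2 $ 1 = 0" "n $ 3 $ 1 = 0"
    using n(1) by (auto simp: torus_normalizer_def)
  have f: "v' 0 = v 0 * n $ 2 $ 2 + v 2 * n $ 3 $ 2" "1 = n $ 2 $ 2 + v 3 * n $ 3 $ 2"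
    "v' 1 = v 1 * n $ 2 $ 2 + v 4 * n $ 3 $ 2" "v' 2 = v 0 * n $ 2 $ 3 + v 2 * n $ 3 $ 3"
    "v' 3 = n $ 2 $ 3 + v 3 * n $ 3 $ 3" "v' 4 = v 1 * n $ 2 $ 3 + v 4 * n $ 3 $ 3"
    "v' 5 = v 5 * n $ 1 $ 1" "v' 6 = v 6 * n $ 1 $ 1"
    using e[of 1 2] e[of 2 2] e[of 3 2] e[of 1 3] e[of 2 3] e[of 3 3] e[of 2 1] e[of 3 1]
    by (simp_all add: normal_form_def matrix_matrix_mult_def sum_3 z)
  show ?thesis
  proof (cases "n $ 2 $ 2 = 0")
    case True
    then have "n $ 3 $ 3 = 0" "n $ 2 $ 3 * n $ 3 $ 2 = 1"
      using n(1) by (auto simp: torus_normalizer_def)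
    then have "v' 1 * v' 3 = v 4" "v' 4 = v 1 * n $ 2 $ 3" "1 = v 3 * n $ 3 $ 2"
      using True f by (simp_all add: mult_ac)
    moreover from this have "v 3 = n $ 2 $ 3"
      using \<open>n $ 2 $ 3 * n $ 3 $ 2 = 1\<close> by (metis mult_right_cancel mult_zero_right zero_neq_one)
    \<comment> \<open>Contradiction: \<bar>v_1 v_3\<bar> < \<bar>v_4\<bar> = \<bar>v'_1 v'_3\<bar> <
      \<bar>v'_4\<bar> = \<bar>v_1 v_3\<bar>.\<close>
    ultimately show ?thesis using v by simp
  next
    case False
    then have "n $ 1 $ 1 = 1" "n $ 2 $ 3 = 0" "n $ 3 $ 2 = 0" "n $ 2 $ 2 * n $ 3 $ 3 = 1"
      using n(1) by (auto simp: torus_normalizer_def)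
    moreover from this have "n $ 2 $ 2 = 1" "n $ 3 $ 3 = 1" using f(2) by auto
    ultimately show ?thesis
      using f by (auto simp: less_Suc_eq numeral_eq_Suc)
  qed
qed

lemma normal_coords_normal_form:
  assumes "v \<in> chart_domain"
  shows "normal_coords (normal_form v) (v 7) = v"
proof
  fix i :: nat
  have "i < 8 \<or> i \<ge> 8" by linarith
  then show "normal_coords (normal_form v) (v 7) i = v i"
    using assms by (auto simp: normal_coords_def normal_form_def chart_domain_def less_Suc_eq numeral_eq_Suc)
qed

lemma continuous_on_normal_form:
  assumes "\<And>v. v \<in> S \<Longrightarrow> \<bar>v 1 * v 3\<bar> < \<bar>v 4\<bar>"
  shows "continuous_on S normal_form"
proof -
  have [continuous_intros]: "continuous_on S (\<lambda>v. v i)" for i :: nat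
    by (rule continuous_on_subset[OF continuous_on_product_coordinates]) simp
  have "v 4 - v 3 * v 1 \<noteq> 0" if "v \<in> S" for v using assms[OF that] by (auto simp: mult.commute)
  then show ?thesis
    unfolding normal_form_def[abs_def] by (intro continuous_intros) auto
qed

lemma Euclidean_space_eq_top_of_set: "Euclidean_space n = top_of_set {x. \<forall>i\<ge>n. x i = 0}"
  by (simp add: Euclidean_space_def euclidean_product_topology)

lemma openin_chart_domain: "openin (Euclidean_space 8) chart_domain"
proof -
  have [continuous_intros]: "continuous_on UNIV (\<lambda>v::nat \<Rightarrow> real. v i)" for i
    by (rule continuous_on_product_coordinates)
  have "open {v::nat \<Rightarrow> real. v 7 > 0 \<and> \<bar>v 1 * v 3\<bar> < \<bar>v 4\<bar>}"
    by (intro open_Collect_conj open_Collect_less continuous_intros)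
  then have "openin (top_of_set {x. \<forall>i\<ge>8. x i = 0}) ({x. \<forall>i\<ge>8. x i = 0} \<inter> {v::nat \<Rightarrow> real. v 7 > 0 \<and> \<bar>v 1 * v 3\<bar> < \<bar>v 4\<bar>})"
    by (rule openin_open_Int)
  also have "{x. \<forall>i\<ge>8. x i = 0} \<inter> {v::nat \<Rightarrow> real. v 7 > 0 \<and> \<bar>v 1 * v 3\<bar> < \<bar>v 4\<bar>} = chart_domain"
    by (auto simp: chart_domain_def)
  finally show ?thesis by (simp add: Euclidean_space_eq_top_of_set)
qed

lemma openin_orbit_chart_domain: "openin (Euclidean_space 7) orbit_chart_domain"
proof -
  have [continuous_intros]: "continuous_on UNIV (\<lambda>v::nat \<Rightarrow> real. v i)" for i
    by (rule continuous_on_product_coordinates)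
  have "open {v::nat \<Rightarrow> real. \<bar>v 1 * v 3\<bar> < \<bar>v 4\<bar>}"
    by (intro open_Collect_less continuous_intros)
  then have "openin (top_of_set {x. \<forall>i\<ge>7. x i = 0}) ({x. \<forall>i\<ge>7. x i = 0} \<inter> {v::nat \<Rightarrow> real. \<bar>v 1 * v 3\<bar> < \<bar>v 4\<bar>})"
    by (rule openin_open_Int)
  also have "{x. \<forall>i\<ge>7. x i = 0} \<inter> {v::nat \<Rightarrow> real. \<bar>v 1 * v 3\<bar> < \<bar>v 4\<bar>} = orbit_chart_domain"
    by (auto simp: orbit_chart_domain_def)
  finally show ?thesis by (simp add: Euclidean_space_eq_top_of_set)
qed

lemma subtopology_chart_domain:
  "subtopology (Euclidean_space 8) chart_domain = top_of_set chart_domain"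
  "subtopology (Euclidean_space 7) orbit_chart_domain = top_of_set orbit_chart_domain"
  unfolding Euclidean_space_eq_top_of_set subtopology_subtopology
  by (auto intro!: arg_cong[where f = top_of_set] simp: chart_domain_def orbit_chart_domain_def)

section \<open>Adapted frames and charts for the family of curves\<close>

definition curve_params :: "((real ^ 3 ^ 3) \<times> real) set" where
  "curve_params = {A. det A = 1} \<times> {0<..}"

definition curve_of :: "(real ^ 3 ^ 3) \<times> real \<Rightarrow> (real ^ 3 ^ 3) set set" where
  "curve_of = (\<lambda>(k, c). translate_curve k (circle_curve c))"

definition adapted_frame :: "(real ^ 3 ^ 3) \<times> real \<Rightarrow> real ^ 3 ^ 3" where
  "adapted_frame x = fst x ** frame (snd x)"

definition of_adapted_frame :: "real ^ 3 ^ 3 \<Rightarrow> real \<Rightarrow> (real ^ 3 ^ 3) \<times> real" where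
  "of_adapted_frame g c = (g ** matrix_inv (frame c), c)"

lemma adapted_frame_simps [simp]:
  "adapted_frame (of_adapted_frame g c) = g" "snd (of_adapted_frame g c) = c"
  "of_adapted_frame (adapted_frame x) (snd x) = x"
  by (simp_all add: adapted_frame_def of_adapted_frame_def matrix_inv_det_1)

lemma of_adapted_frame_in_curve_params [simp]:
  "of_adapted_frame g c \<in> curve_params \<longleftrightarrow> det g = 1 \<and> c > 0"
  by (simp add: of_adapted_frame_def curve_params_def det_mul matrix_inv_det_1)

lemma curve_paramsD:
  assumes "x \<in> curve_params"
  shows "det (adapted_frame x) = 1" "snd x > 0"
  using assms by (auto simp: curve_params_def adapted_frame_def det_mul)

lemma curve_of_eq_iff:
  assumes "x \<in> curve_params" "y \<in> curve_params"
  shows "curve_of x = curve_of y \<longleftrightarrow>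
    snd x = snd y \<and> (\<exists>n\<in>torus_normalizer. adapted_frame y = adapted_frame x ** n)"
  using assms translate_circle_curve_eq_iff[of "snd x" "snd y" "fst x" "fst y"]
  by (auto simp: curve_params_def curve_of_def adapted_frame_def)

lemma continuous_on_frame:
  assumes "\<And>x. x \<in> S \<Longrightarrow> f x > 0" "continuous_on S f"
  shows "continuous_on S (\<lambda>x. frame (f x))" "continuous_on S (\<lambda>x. matrix_inv (frame (f x)))"
proof -
  have "f x \<noteq> 0" if "x \<in> S" for x using assms(1)[OF that] by simp
  then show "continuous_on S (\<lambda>x. frame (f x))" "continuous_on S (\<lambda>x. matrix_inv (frame (f x)))"
    unfolding matrix_inv_frame unfolding frame_def
    by (intro continuous_intros assms(2); simp)+
qed

lemma continuous_on_adapted_frame: "continuous_on curve_params adapted_frame"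
  unfolding adapted_frame_def[abs_def]
  by (intro continuous_intros continuous_on_frame) (auto simp: curve_params_def)

lemma continuous_on_of_adapted_frame:
  assumes "continuous_on S g" "continuous_on S c" "\<And>x. x \<in> S \<Longrightarrow> c x > 0"
  shows "continuous_on S (\<lambda>x. of_adapted_frame (g x) (c x))"
  unfolding of_adapted_frame_def
  by (intro continuous_intros continuous_on_frame assms)

text \<open>On adapted frames the normalizer acts from the right by the continuous maps
  \<open>R n\<close>, and its orbits are the fibres of \<open>curve_of\<close>. The saturation of
  \<open>U\<close> is thus a union of open preimages.\<close>

lemma openin_curve_of_saturation:
  assumes U: "openin (top_of_set curve_params) U"
  shows "openin (top_of_set curve_params) {x \<in> curve_params. curve_of x \<in> curve_of ` U}"
proof -
  define R where "R n x = of_adapted_frame (adapted_frame x ** n) (snd x)" for n x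
  have sub: "U \<subseteq> curve_params" using openin_imp_subset[OF U] .
  have R: "R n x \<in> curve_params" if "n \<in> torus_normalizer" "x \<in> curve_params" for n x
    using that by (simp add: R_def curve_paramsD det_mul det_torus_normalizer)
  have Req: "curve_of (R n x) = curve_of x" if "n \<in> torus_normalizer" "x \<in> curve_params" for n x
    using that R[OF that] by (subst eq_commute) (auto simp: curve_of_eq_iff R_def)
  have eq: "{x \<in> curve_params. curve_of x \<in> curve_of ` U} = (\<Union>n\<in>torus_normalizer. curve_params \<inter> R n -` U)"
  proof (intro equalityI subsetI)
    fix x assume "x \<in> {x \<in> curve_params. curve_of x \<in> curve_of ` U}"
    then obtain u where x: "x \<in> curve_params" and u: "u \<in> U" "curve_of x = curve_of u" by auto
    then obtain n where n: "n \<in> torus_normalizer" "snd x = snd u" "adapted_frame u = adapted_frame x ** n"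
      using curve_of_eq_iff[of x u] sub by auto
    then have "R n x = u" by (metis R_def adapted_frame_simps(3))
    then show "x \<in> (\<Union>n\<in>torus_normalizer. curve_params \<inter> R n -` U)"
      using n x u by auto
  next
    fix x assume "x \<in> (\<Union>n\<in>torus_normalizer. curve_params \<inter> R n -` U)"
    then obtain n where "n \<in> torus_normalizer" "x \<in> curve_params" "R n x \<in> U" by auto
    with Req[of n x] show "x \<in> {x \<in> curve_params. curve_of x \<in> curve_of ` U}"
      by (metis (mono_tags, lifting) imageI mem_Collect_eq)
  qed
  have "openin (top_of_set curve_params) (curve_params \<inter> R n -` U)" if n: "n \<in> torus_normalizer" for n
  proof (rule continuous_openin_preimage[OF _ _ U])
    show "continuous_on curve_params (R n)"
      unfolding R_def[abs_def]
      by (intro continuous_on_of_adapted_frame continuous_intros continuous_on_adapted_frame)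
        (auto simp: curve_paramsD)
    show "R n \<in> curve_params \<rightarrow> curve_params" using R n by auto
  qed
  then show ?thesis unfolding eq by (intro openin_Union) auto
qed

text \<open>The slice through the identity given by \<open>normal_form\<close>, moved by left
  multiplication to the adapted frame \<open>b\<close>. Left multiplication commutes with the right
  action of the normalizer.\<close>

definition chart :: "real ^ 3 ^ 3 \<Rightarrow> (nat \<Rightarrow> real) \<Rightarrow> (real ^ 3 ^ 3) set set" where
  "chart b v = curve_of (of_adapted_frame (b ** normal_form v) (v 7))"

lemma chart_domain_in_curve_params:
  assumes "v \<in> chart_domain" "det b = 1"
  shows "of_adapted_frame (b ** normal_form v) (v 7) \<in> curve_params"
  using assms by (simp add: chart_domain_def det_mul det_normal_form)

lemma curve_of_eq_chart:
  assumes b: "det b = 1" and x: "x \<in> curve_params"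
    and g: "g = matrix_inv b ** adapted_frame x" "\<bar>g $ 3 $ 2 * g $ 2 $ 3\<bar> < \<bar>g $ 3 $ 3 * g $ 2 $ 2\<bar>"
  shows "chart b (normal_coords g (snd x)) = curve_of x" "normal_coords g (snd x) \<in> chart_domain"
proof -
  have "det g = 1" by (simp add: g det_mul matrix_inv_det_1[OF b] curve_paramsD[OF x])
  then obtain n where n: "n \<in> torus_normalizer" "normal_form (normal_coords g (snd x)) = g ** n"
    using normal_form_normal_coords g(2) by blast
  have bg: "b ** g = adapted_frame x"
    by (simp add: g matrix_mul_assoc matrix_inv_det_1[OF b])
  show dom: "normal_coords g (snd x) \<in> chart_domain"
  proof -
    have "g $ 2 $ 2 \<noteq> 0" using g(2) by auto
    then have "g $ 3 $ 2 / g $ 2 $ 2 * (g $ 2 $ 3 * g $ 2 $ 2) = g $ 3 $ 2 * g $ 2 $ 3" by simp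
    then show ?thesis
      using g(2) curve_paramsD[OF x] by (simp add: chart_domain_def normal_coords_def)
  qed
  have 7: "normal_coords g (snd x) 7 = snd x" by (simp add: normal_coords_def)
  show "chart b (normal_coords g (snd x)) = curve_of x"
    using curve_of_eq_iff[OF x chart_domain_in_curve_params[OF dom b]] n(1)
    by (auto simp: chart_def 7 n(2) matrix_mul_assoc bg)
qed

lemma inj_on_chart:
  assumes b: "det b = 1"
  shows "inj_on (chart b) chart_domain"
proof (rule inj_onI)
  fix v v' assume v: "v \<in> chart_domain" "v' \<in> chart_domain" "chart b v = chart b v'"
  then obtain n where n: "v 7 = v' 7" "n \<in> torus_normalizer" "b ** normal_form v' = b ** normal_form v ** n"
    using curve_of_eq_iff[OF chart_domain_in_curve_params[OF v(1) b] chart_domain_in_curve_params[OF v(2) b]]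
    by (auto simp: chart_def)
  then have "matrix_inv b ** (b ** normal_form v') = matrix_inv b ** (b ** normal_form v ** n)" by simp
  then have "normal_form v' = normal_form v ** n"
    by (simp add: matrix_mul_assoc matrix_inv_det_1[OF b])
  then have "\<forall>i<7. v i = v' i"
    using normal_form_inject n(2) v by (auto simp: chart_domain_def)
  moreover have "v i = v' i" if "i \<ge> 8" for i using v that by (simp add: chart_domain_def)
  moreover have "i < 7 \<or> i = 7 \<or> i \<ge> 8" for i :: nat by linarith
  ultimately show "v = v'" using n(1) by (metis ext)
qed

text \<open>The coordinates of the identity matrix: index 4 is the (3, 3) entry, the (2, 2) entry is
  built into \<open>normal_form\<close>, and the (1, 1) entry follows from the determinant.\<close>

definition base_coords :: "real \<Rightarrow> nat \<Rightarrow> real" where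
  "base_coords c i = (if i = 4 then 1 else if i = 7 then c else 0)"

lemma base_coords:
  assumes "x \<in> curve_params"
  shows "base_coords (snd x) \<in> chart_domain" "chart (adapted_frame x) (base_coords (snd x)) = curve_of x"
proof -
  have b: "det (adapted_frame x) = 1" using curve_paramsD[OF assms] by simp
  have g: "mat 1 = matrix_inv (adapted_frame x) ** adapted_frame x"
    by (simp add: matrix_inv_det_1[OF b])
  have nc: "normal_coords (mat 1) (snd x) = base_coords (snd x)"
    by (simp add: fun_eq_iff normal_coords_def base_coords_def mat_def)
  show "base_coords (snd x) \<in> chart_domain" "chart (adapted_frame x) (base_coords (snd x)) = curve_of x"
    using curve_of_eq_chart[OF b assms g] unfolding nc by (simp_all add: mat_def)
qed

lemma continuous_on_const_if:
  assumes "P \<Longrightarrow> continuous_on S f" "\<not> P \<Longrightarrow> continuous_on S g"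
  shows "continuous_on S (\<lambda>x. if P then f x else g x)"
  using assms by (cases P) auto

lemma continuous_on_update: "continuous_on S (\<lambda>v :: nat \<Rightarrow> real. v(j := c))"
proof (rule continuous_on_coordinatewise_then_product)
  have "continuous_on S (\<lambda>v :: nat \<Rightarrow> real. v i)" for i
    by (rule continuous_on_subset[OF continuous_on_product_coordinates]) simp
  then show "continuous_on S (\<lambda>v :: nat \<Rightarrow> real. (v(j := c)) i)" for i
    by (cases "i = j") auto
qed

section \<open>The quotient topology and its manifold structure\<close>

locale curve_space =
  fixes N :: "(real ^ 3 ^ 3) set set topology"
  assumes quotient: "quotient_map (top_of_set curve_params) N curve_of"
begin

lemma open_map_curve_of: "open_map (top_of_set curve_params) N curve_of"
  by (rule quotient_map_imp_open_map[OF quotient]) (simp add: openin_curve_of_saturation)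

lemma topspace_N: "topspace N = curve_of ` curve_params"
  using quotient by (simp add: quotient_map_def)

lemma second_countable_N: "second_countable N"
  by (rule second_countable_open_map_image[OF quotient_imp_continuous_map[OF quotient] open_map_curve_of])
    (simp_all add: topspace_N second_countable_subtopology second_countable_euclidean)

lemma Hausdorff_space_N: "Hausdorff_space N"
proof -
  define frame_invariant where "frame_invariant x = (snd x, adapted_frame x ** e11 ** transpose (adapted_frame x),
    adapted_frame x ** e23 ** transpose (adapted_frame x))" for x
  have inv_iff: "frame_invariant x = frame_invariant y \<longleftrightarrow> curve_of x = curve_of y"
    if x: "x \<in> curve_params" and y: "y \<in> curve_params" for x y
  proof -
    define g h where "g = adapted_frame x" and "h = matrix_inv g ** adapted_frame y"
    have g: "det g = 1" by (simp add: g_def curve_paramsD x)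
    have h: "adapted_frame y = g ** h"
      by (simp add: h_def matrix_mul_assoc matrix_inv_det_1[OF g])
    have "transpose g ** transpose (matrix_inv g) = mat 1"
      by (metis matrix_inv_det_1(1)[OF g] matrix_transpose_mul transpose_mat)
    then have tr: "A ** transpose g ** transpose (matrix_inv g) = A" for A :: "real ^ 3 ^ 3"
      by (simp flip: matrix_mul_assoc)
    have can: "g ** e ** transpose g = g ** h ** e ** transpose (g ** h) \<longleftrightarrow> h ** e ** transpose h = e"
      for e :: "real ^ 3 ^ 3"
    proof
      assume "g ** e ** transpose g = g ** h ** e ** transpose (g ** h)"
      then have "matrix_inv g ** (g ** e ** transpose g) ** transpose (matrix_inv g)
        = matrix_inv g ** (g ** h ** e ** transpose (g ** h)) ** transpose (matrix_inv g)" by simp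
      then show "h ** e ** transpose h = e"
        by (simp add: matrix_mul_assoc matrix_transpose_mul matrix_inv_det_1[OF g] tr)
    next
      assume "h ** e ** transpose h = e"
      then have "g ** e ** transpose g = g ** (h ** e ** transpose h) ** transpose g" by simp
      then show "g ** e ** transpose g = g ** h ** e ** transpose (g ** h)"
        by (simp add: matrix_mul_assoc matrix_transpose_mul)
    qed
    have "det h = 1" by (simp add: h_def det_mul matrix_inv_det_1[OF g] curve_paramsD[OF y])
    then have "frame_invariant x = frame_invariant y \<longleftrightarrow> snd x = snd y \<and> h \<in> torus_normalizer"
      unfolding frame_invariant_def torus_normalizer_iff h g_def[symmetric] by (simp add: can)
    also have "\<dots> \<longleftrightarrow> curve_of x = curve_of y"
    proof -
      have "g ** h = g ** n \<longleftrightarrow> h = n" for n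
        by (metis matrix_inv_det_1(1)[OF g] matrix_mul_assoc matrix_mul_lid)
      then show ?thesis
        unfolding curve_of_eq_iff[OF x y] h g_def[symmetric] by auto
    qed
    finally show ?thesis .
  qed
  have "continuous_on curve_params frame_invariant"
    unfolding frame_invariant_def[abs_def] by (intro continuous_intros continuous_on_adapted_frame)
  then have cont: "continuous_map (top_of_set curve_params) euclidean frame_invariant" by simp
  \<comment> \<open>\<open>frame_invariant\<close> is constant exactly on the fibres, so it descends
    to a continuous injection of \<open>N\<close> into a Hausdorff space.\<close>
  obtain f where f: "continuous_map N euclidean f" "\<And>x. x \<in> curve_params \<Longrightarrow> f (curve_of x) = frame_invariant x"
    using quotient_map_lift_exists[OF quotient cont] inv_iff by (metis topspace_euclidean_subtopology)
  have "inj_on f (topspace N)"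
    unfolding topspace_N using f(2) inv_iff by (auto intro!: inj_onI)
  then show ?thesis
    using Hausdorff_space_injective_preimage[OF Hausdorff_space_euclidean f(1)] by blast
qed

lemma continuous_map_chart:
  assumes b: "det b = 1"
  shows "continuous_map (top_of_set chart_domain) N (chart b)"
proof -
  have "continuous_on chart_domain (\<lambda>v. v 7)"
    by (rule continuous_on_subset[OF continuous_on_product_coordinates]) simp
  then have "continuous_on chart_domain (\<lambda>v. of_adapted_frame (b ** normal_form v) (v 7))"
    by (intro continuous_on_of_adapted_frame continuous_intros continuous_on_normal_form)
      (auto simp: chart_domain_def)
  then have "continuous_map (top_of_set chart_domain) (top_of_set curve_params)
      (\<lambda>v. of_adapted_frame (b ** normal_form v) (v 7))"
    using chart_domain_in_curve_params[OF _ b] by (auto simp: continuous_map_in_subtopology)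
  from continuous_map_compose[OF this quotient_imp_continuous_map[OF quotient]]
  show ?thesis by (simp add: comp_def chart_def[abs_def])
qed

lemma open_map_chart:
  assumes b: "det b = 1"
  shows "open_map (top_of_set chart_domain) N (chart b)"
  unfolding open_map_def
proof (intro allI impI)
  fix V assume V: "openin (top_of_set chart_domain) V"
  then have sub: "V \<subseteq> chart_domain" by (rule openin_imp_subset)
  define h where "h x = matrix_inv b ** adapted_frame x" for x
  define W where "W = {x \<in> curve_params. \<bar>h x $ 3 $ 2 * h x $ 2 $ 3\<bar> < \<bar>h x $ 3 $ 3 * h x $ 2 $ 2\<bar>}"
  \<comment> \<open>The parameters whose normal coordinates lie in \<open>V\<close>. This set is
    open and has the same image under \<open>curve_of\<close> as \<open>V\<close> has under the
    chart, so openness of \<open>curve_of\<close> carries over.\<close>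
  define T where "T = W \<inter> (\<lambda>x. normal_coords (h x) (snd x)) -` V"
  have ch: "continuous_on curve_params h"
    unfolding h_def[abs_def] by (intro continuous_intros continuous_on_adapted_frame)
  have "openin (top_of_set curve_params) W"
  proof -
    have "continuous_on curve_params
        (\<lambda>x. \<bar>h x $ 3 $ 3 * h x $ 2 $ 2\<bar> - \<bar>h x $ 3 $ 2 * h x $ 2 $ 3\<bar>)"
      by (intro continuous_intros ch)
    from continuous_openin_preimage_gen[OF this open_greaterThan[of 0]] show ?thesis
      by (simp add: W_def Int_def vimage_def)
  qed
  moreover have "openin (top_of_set W) T"
    unfolding T_def
  proof (rule continuous_openin_preimage[OF _ _ V])
    have cW: "continuous_on W h" by (rule continuous_on_subset[OF ch]) (auto simp: W_def)
    have nz: "h x $ 2 $ 2 \<noteq> 0" if "x \<in> W" for x using that by (auto simp: W_def)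
    show "continuous_on W (\<lambda>x. normal_coords (h x) (snd x))"
    proof (rule continuous_on_coordinatewise_then_product)
      show "continuous_on W (\<lambda>x. normal_coords (h x) (snd x) i)" for i
        unfolding normal_coords_def
        by (intro continuous_on_const_if continuous_intros cW) (simp_all add: nz)
    qed
    show "(\<lambda>x. normal_coords (h x) (snd x)) \<in> W \<rightarrow> chart_domain"
      using curve_of_eq_chart(2)[OF b] by (auto simp: W_def h_def)
  qed
  ultimately have "openin (top_of_set curve_params) T" by (rule openin_trans[rotated])
  then have "openin N (curve_of ` T)"
    using open_map_curve_of by (simp add: open_map_def)
  moreover have "curve_of ` T = chart b ` V"
  proof (intro equalityI subsetI)
    fix p assume "p \<in> curve_of ` T"
    then obtain x where x: "x \<in> W" "normal_coords (h x) (snd x) \<in> V" "p = curve_of x"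
      by (auto simp: T_def)
    then have "chart b (normal_coords (h x) (snd x)) = p"
      using curve_of_eq_chart(1)[OF b _ h_def[of x]] by (auto simp: W_def)
    then show "p \<in> chart b ` V" using x(2) by blast
  next
    fix p assume "p \<in> chart b ` V"
    then obtain v where v: "v \<in> V" "p = chart b v" by auto
    define x where "x = of_adapted_frame (b ** normal_form v) (v 7)"
    have vd: "v \<in> chart_domain" using v sub by auto
    have x: "x \<in> curve_params" unfolding x_def by (rule chart_domain_in_curve_params[OF vd b])
    have hx: "h x = normal_form v"
      by (simp add: h_def x_def matrix_mul_assoc matrix_inv_det_1[OF b])
    have "x \<in> W"
      using vd x by (simp add: W_def hx) (simp add: normal_form_def chart_domain_def)
    moreover have "normal_coords (h x) (snd x) = v"
      using normal_coords_normal_form[OF vd] by (simp add: hx x_def[symmetric]) (simp add: x_def)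
    ultimately have "x \<in> T" using v by (simp add: T_def)
    moreover have "p = curve_of x" by (simp add: v chart_def x_def)
    ultimately show "p \<in> curve_of ` T" by blast
  qed
  ultimately show "openin N (chart b ` V)" by simp
qed

lemma topological_manifold_N: "topological_manifold 8 N"
proof (rule topological_manifoldI[OF Hausdorff_space_N second_countable_N])
  fix p assume "p \<in> topspace N"
  then obtain x where x: "x \<in> curve_params" "p = curve_of x" by (auto simp: topspace_N)
  let ?b = "adapted_frame x"
  have b: "det ?b = 1" using curve_paramsD[OF x(1)] by simp
  have "p \<in> chart ?b ` chart_domain"
    using base_coords[OF x(1)] x(2) by (metis imageI)
  then show "\<exists>V f. openin (Euclidean_space 8) V \<and>
      continuous_map (subtopology (Euclidean_space 8) V) N f \<and>
      open_map (subtopology (Euclidean_space 8) V) N f \<and> inj_on f V \<and> p \<in> f ` V"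
    using openin_chart_domain continuous_map_chart[OF b] open_map_chart[OF b] inj_on_chart[OF b]
    by (intro exI[of _ chart_domain] exI[of _ "chart ?b"]) (simp add: subtopology_chart_domain)
qed

lemma topological_manifold_orbit:
  assumes c: "c > 0"
  shows "topological_manifold 7 (subtopology N ((\<lambda>k. curve_of (k, c)) ` {k. det k = 1}))"
    (is "topological_manifold 7 (subtopology N ?T)")
proof (rule topological_manifoldI)
  show "Hausdorff_space (subtopology N ?T)" "second_countable (subtopology N ?T)"
    by (simp_all add: Hausdorff_space_N second_countable_N Hausdorff_space_subtopology second_countable_subtopology)
  \<comment> \<open>Different parameters give disjoint orbits, so the orbit is a level set of
    \<open>c\<close>; inside a chart it is the slice \<open>v 7 = c\<close>.\<close>
  have T: "curve_of x \<in> ?T \<longleftrightarrow> snd x = c" if x: "x \<in> curve_params" for x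
  proof
    assume "curve_of x \<in> ?T"
    then obtain k where "det k = 1" "curve_of x = curve_of (k, c)" by auto
    then show "snd x = c"
      using curve_of_eq_iff[OF x, of "(k, c)"] c by (auto simp: curve_params_def)
  qed (use x in \<open>auto simp: curve_params_def\<close>)
  fix p assume "p \<in> topspace (subtopology N ?T)"
  then obtain k where k: "det k = 1" and p: "p = curve_of (k, c)" by auto
  have x: "(k, c) \<in> curve_params" using k c by (simp add: curve_params_def)
  let ?b = "adapted_frame (k, c)"
  have b: "det ?b = 1" using curve_paramsD[OF x] by simp
  have chT: "chart ?b v \<in> ?T \<longleftrightarrow> v 7 = c" if "v \<in> chart_domain" for v
    unfolding chart_def using T[OF chart_domain_in_curve_params[OF that b]] by simp
  \<comment> \<open>Points of \<open>Euclidean_space 7\<close> are 0 at index 7, so the parameter is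
    inserted there before the chart of \<open>N\<close> is applied.\<close>
  define f where "f v = chart ?b (v(7 := c))" for v
  have dom: "v(7 := c) \<in> chart_domain" if "v \<in> orbit_chart_domain" for v
    using that c by (auto simp: chart_domain_def orbit_chart_domain_def)
  have dom': "v(7 := 0) \<in> orbit_chart_domain" if "v \<in> chart_domain" for v
    using that by (auto simp: chart_domain_def orbit_chart_domain_def)
  have "continuous_map (top_of_set orbit_chart_domain) (top_of_set chart_domain) (\<lambda>v. v(7 := c))"
    using dom by (auto simp: continuous_map_in_subtopology continuous_on_update)
  from continuous_map_compose[OF this continuous_map_chart[OF b]]
  have "continuous_map (top_of_set orbit_chart_domain) (subtopology N ?T) f"
    using chT[OF dom] by (auto simp: continuous_map_in_subtopology comp_def f_def[abs_def])
  moreover have "open_map (top_of_set orbit_chart_domain) (subtopology N ?T) f"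
    unfolding open_map_def
  proof (intro allI impI)
    fix V assume V: "openin (top_of_set orbit_chart_domain) V"
    then have sub: "V \<subseteq> orbit_chart_domain" by (rule openin_imp_subset)
    let ?V = "chart_domain \<inter> (\<lambda>v. v(7 := 0)) -` V"
    have "openin (top_of_set chart_domain) ?V"
      by (rule continuous_openin_preimage[OF continuous_on_update _ V]) (use dom' in auto)
    then have "openin N (chart ?b ` ?V)"
      using open_map_chart[OF b] by (simp add: open_map_def)
    moreover have "f ` V = ?T \<inter> chart ?b ` ?V"
    proof (intro equalityI subsetI)
      fix q assume "q \<in> f ` V"
      then obtain v where v: "v \<in> V" "q = chart ?b (v(7 := c))" by (auto simp: f_def)
      have "v \<in> orbit_chart_domain" using v sub by auto
      moreover from this have "(v(7 := c))(7 := 0) = v" by (auto simp: orbit_chart_domain_def)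
      ultimately have "v(7 := c) \<in> ?V" using v dom by simp
      moreover have "q \<in> ?T" using chT[OF dom, of v] v \<open>v \<in> orbit_chart_domain\<close> by simp
      ultimately show "q \<in> ?T \<inter> chart ?b ` ?V" using v by blast
    next
      fix q assume "q \<in> ?T \<inter> chart ?b ` ?V"
      then obtain v where v: "v \<in> chart_domain" "v(7 := 0) \<in> V" "q = chart ?b v" "q \<in> ?T" by auto
      then have "(v(7 := 0))(7 := c) = v" using chT[of v] by auto
      then have "q = f (v(7 := 0))" using v by (simp add: f_def)
      then show "q \<in> f ` V" using v by blast
    qed
    ultimately show "openin (subtopology N ?T) (f ` V)"
      by (simp add: openin_subtopology_Int2)
  qed
  moreover have "inj_on f orbit_chart_domain"
  proof (rule inj_onI)
    fix v w assume vw: "v \<in> orbit_chart_domain" "w \<in> orbit_chart_domain" "f v = f w"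
    then have "v(7 := c) = w(7 := c)"
      using inj_on_chart[OF b] dom by (auto simp: f_def inj_on_def)
    moreover have "v 7 = w 7" using vw by (simp add: orbit_chart_domain_def)
    ultimately show "v = w" by (metis fun_upd_triv fun_upd_upd)
  qed
  moreover have "p \<in> f ` orbit_chart_domain"
  proof
    have "(base_coords c)(7 := 0, 7 := c) = base_coords c" by (auto simp: base_coords_def)
    then show "p = f ((base_coords c)(7 := 0))"
      using base_coords(2)[OF x] by (simp add: f_def p)
    show "(base_coords c)(7 := 0) \<in> orbit_chart_domain"
      using dom'[OF base_coords(1)[OF x]] by simp
  qed
  ultimately show "\<exists>V f. openin (Euclidean_space 7) V \<and>
      continuous_map (subtopology (Euclidean_space 7) V) (subtopology N ?T) f \<and>
      open_map (subtopology (Euclidean_space 7) V) (subtopology N ?T) f \<and> inj_on f V \<and> p \<in> f ` V"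
    using openin_orbit_chart_domain
    by (intro exI[of _ orbit_chart_domain] exI[of _ f]) (simp add: subtopology_chart_domain)
qed

end

lemma orbit_of_circles: "orbit_of_cohomogeneity_one SL3 translate_curve {0<..} circle_curve"
proof -
  obtain N where N: "quotient_map (top_of_set curve_params) N curve_of"
    using quotient_topology_exists[of "top_of_set curve_params" curve_of] by metis
  then interpret curve_space N by unfold_locales
  have [simp]: "carrier SL3 = {k. det k = 1}" by (simp add: SL3_def)
  have "topological_manifold 7 (subtopology N ((\<lambda>k. translate_curve k (circle_curve c)) ` carrier SL3))"
    if "c \<in> {0<..}" for c
    using topological_manifold_orbit[of c] that by (simp add: curve_of_def)
  moreover have "quotient_map (prod_topology (top_of_set (carrier SL3)) (top_of_set {0<..})) N
      (\<lambda>(k, c). translate_curve k (circle_curve c))"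
    using N by (simp add: curve_params_def curve_of_def)
  ultimately show ?thesis
    unfolding orbit_of_cohomogeneity_one_def
    using topological_manifold_N by (intro exI[of _ N] exI[of _ 7]) simp
qed

theorem theorem5p1:
  shows "(\<forall>c::real. c > 0 \<longrightarrow> conformal_circle_on split_fubini_study {t. t \<noteq> 0} (circle c))
       \<and> orbit_of_cohomogeneity_one SL3 translate_curve {0<..} circle_curve"
  using conformal_circle_circle orbit_of_circles by blast

end
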